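(* Suppose $E:\mathcal{P}_{2,\omega_0}(\mathbb{R}^d)\to\mathbb{R}\cup\{+\infty\}$ is proper, coercive, lower semicontinuous and $\lambda$-convex along generalized geodesics for some $\lambda\in\mathbb{R}$. Let $\mu\in\overline{D(E)}$ and $0<h\le\tau<\frac1{\lambda^-}$, and write $\mu_\tau=J_\tau\mu$. Then for any constant speed $W_2$-geodesic $(\mu_\alpha^{\mu_\tau\to\mu})_{\alpha\in[0,1]}$ from $\mu_\tau$ to $\mu$, $$J_\tau\mu=J_h\big[\mu^{\mu_\tau\to\mu}_{h/\tau}\big].$$
   Context: Fix a probability measure $\omega_0$ on $\mathbb{R}^d$. $W_2$ is the quadratic Wasserstein distance, $\Gamma_0$ the optimal couplings; $\mathcal{P}_{2,\omega_0}(\mathbb{R}^d)=\{\mu:W_2(\mu,\omega_0)<\infty\}$. A curve $u_\alpha$, $\alpha\in[0,1]$, is a constant speed geodesic if $W_2(u_\alpha,u_\beta)=|\beta-\alpha|W_2(u_0,u_1)$ for all $\alpha,\beta$. A transport plan from $\mu_0$ to $\mu_1$ with base $\omega$ is $\boldsymbol\omega\in\mathcal{P}((\mathbb{R}^d)^3)$ with $\pi^{1,2}\#\boldsymbol\omega\in\Gamma_0(\omega,\mu_0)$, $\pi^{1,3}\#\boldsymbol\omega\in\Gamma_0(\omega,\mu_1)$; generalized geodesic $\mu_\alpha=((1-\alpha)\pi^2+\alpha\pi^3)\#\boldsymbol\omega$; $W_{2,\boldsymbol\omega}(\mu_0,\mu_1)=(\int|x_2-x_3|^2d\boldsymbol\omega)^{1/2}$.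 $D(E)=\{E<\infty\}$; proper: $D(E)\ne\emptyset$; coercive: $\exists\tau_0>0,u_0$ with $\inf_v\{\frac1{2\tau_0}W_2^2(u_0,v)+E(v)\}>-\infty$; lower semicontinuous w.r.t. $W_2$; $\lambda$-convex along generalized geodesics: for all $\mu_0,\mu_1,\omega$ there is a generalized geodesic from $\mu_0$ to $\mu_1$ with base $\omega$ (induced by some $\boldsymbol\omega$) with $E(\mu_\alpha)\le(1-\alpha)E(\mu_0)+\alpha E(\mu_1)-\alpha(1-\alpha)\frac\lambda2W^2_{2,\boldsymbol\omega}(\mu_0,\mu_1)$. $\lambda^-=\max\{0,-\lambda\}$, $1/\lambda^-=+\infty$ if $\lambda^-=0$; $\overline{D(E)}$ is the $W_2$-closure. $J_\tau\mu=\operatorname{argmin}_{\nu\in\mathcal{P}_{2,\omega_0}}\{\frac1{2\tau}W_2^2(\mu,\nu)+E(\nu)\}$ (well defined for $\mu\in\overline{D(E)}$, $0<\tau<1/\lambda^-$). *)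

theory Defs
  imports "HOL-Probability.Probability"
begin

definition prob_borel :: "'a::euclidean_space measure \<Rightarrow> bool" where
  "prob_borel \<mu> \<longleftrightarrow> prob_space \<mu> \<and> sets \<mu> = sets borel"

definition couplings :: "'a::euclidean_space measure \<Rightarrow> 'a measure \<Rightarrow> ('a \<times> 'a) measure set" where
  "couplings \<mu> \<nu> = {\<gamma>. prob_space \<gamma> \<and> sets \<gamma> = sets borel \<and>
      distr \<gamma> borel fst = \<mu> \<and> distr \<gamma> borel snd = \<nu>}"

definition transport_cost :: "('a::euclidean_space \<times> 'a) measure \<Rightarrow> ennreal" where
  "transport_cost \<gamma> = (\<integral>\<^sup>+ p. ennreal ((norm (fst p - snd p))\<^sup>2) \<partial>\<gamma>)"

text \<open>Squared Wasserstein distance W_2^2 (infinite if there is no coupling).\<close>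
definition W2sq :: "'a::euclidean_space measure \<Rightarrow> 'a measure \<Rightarrow> ennreal" where
  "W2sq \<mu> \<nu> = (INF \<gamma>\<in>couplings \<mu> \<nu>. transport_cost \<gamma>)"

definition W2 :: "'a::euclidean_space measure \<Rightarrow> 'a measure \<Rightarrow> ennreal" where
  "W2 \<mu> \<nu> = (if W2sq \<mu> \<nu> = \<top> then \<top> else ennreal (sqrt (enn2real (W2sq \<mu> \<nu>))))"

definition opt_couplings :: "'a::euclidean_space measure \<Rightarrow> 'a measure \<Rightarrow> ('a \<times> 'a) measure set" where
  "opt_couplings \<mu> \<nu> = {\<gamma>\<in>couplings \<mu> \<nu>. transport_cost \<gamma> = W2sq \<mu> \<nu>}"

definition P2 :: "'a::euclidean_space measure \<Rightarrow> 'a measure set" where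
  "P2 \<omega>0 = {\<mu>. prob_borel \<mu> \<and> W2 \<mu> \<omega>0 < \<top>}"

definition const_speed_geodesic :: "(real \<Rightarrow> 'a::euclidean_space measure) \<Rightarrow> bool" where
  "const_speed_geodesic u \<longleftrightarrow>
     (\<forall>\<alpha>\<in>{0..1}. \<forall>\<beta>\<in>{0..1}. W2 (u \<alpha>) (u \<beta>) = ennreal \<bar>\<beta> - \<alpha>\<bar> * W2 (u 0) (u 1))"

definition transport_plans_base ::
  "'a::euclidean_space measure \<Rightarrow> 'a measure \<Rightarrow> 'a measure \<Rightarrow> ('a \<times> 'a \<times> 'a) measure set" where
  "transport_plans_base \<omega> \<mu>0 \<mu>1 = {\<Omega>. prob_space \<Omega> \<and> sets \<Omega> = sets borel \<and>
      distr \<Omega> borel (\<lambda>(x1, x2, x3). (x1, x2)) \<in> opt_couplings \<omega> \<mu>0 \<and>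
      distr \<Omega> borel (\<lambda>(x1, x2, x3). (x1, x3)) \<in> opt_couplings \<omega> \<mu>1}"

definition gen_geodesic :: "('a::euclidean_space \<times> 'a \<times> 'a) measure \<Rightarrow> real \<Rightarrow> 'a measure" where
  "gen_geodesic \<Omega> \<alpha> = distr \<Omega> borel (\<lambda>(x1, x2, x3). (1 - \<alpha>) *\<^sub>R x2 + \<alpha> *\<^sub>R x3)"

definition W2_plan_sq :: "('a::euclidean_space \<times> 'a \<times> 'a) measure \<Rightarrow> ennreal" where
  "W2_plan_sq \<Omega> = (\<integral>\<^sup>+ p. ennreal ((norm (fst (snd p) - snd (snd p)))\<^sup>2) \<partial>\<Omega>)"

definition proper_energy :: "'a::euclidean_space measure \<Rightarrow> ('a measure \<Rightarrow> ereal) \<Rightarrow> bool" where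
  "proper_energy \<omega>0 E \<longleftrightarrow> (\<exists>\<mu>\<in>P2 \<omega>0. E \<mu> < \<infinity>)"

definition coercive_energy :: "'a::euclidean_space measure \<Rightarrow> ('a measure \<Rightarrow> ereal) \<Rightarrow> bool" where
  "coercive_energy \<omega>0 E \<longleftrightarrow> (\<exists>\<tau>0>0. \<exists>u0\<in>P2 \<omega>0.
      (INF v\<in>P2 \<omega>0. ereal (1 / (2 * \<tau>0)) * enn2ereal ((W2 u0 v)\<^sup>2) + E v) > -\<infinity>)"

definition lsc_energy :: "'a::euclidean_space measure \<Rightarrow> ('a measure \<Rightarrow> ereal) \<Rightarrow> bool" where
  "lsc_energy \<omega>0 E \<longleftrightarrow> (\<forall>\<mu>s \<mu>. (\<forall>n. \<mu>s n \<in> P2 \<omega>0) \<longrightarrow> \<mu> \<in> P2 \<omega>0 \<longrightarrow>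
      ((\<lambda>n. W2 (\<mu>s n) \<mu>) \<longlongrightarrow> 0) sequentially \<longrightarrow> E \<mu> \<le> liminf (\<lambda>n. E (\<mu>s n)))"

definition convex_gen_geod :: "'a::euclidean_space measure \<Rightarrow> ('a measure \<Rightarrow> ereal) \<Rightarrow> real \<Rightarrow> bool" where
  "convex_gen_geod \<omega>0 E lam \<longleftrightarrow> (\<forall>\<mu>0\<in>P2 \<omega>0. \<forall>\<mu>1\<in>P2 \<omega>0. \<forall>\<omega>\<in>P2 \<omega>0.
      \<exists>\<Omega>\<in>transport_plans_base \<omega> \<mu>0 \<mu>1. \<forall>\<alpha>\<in>{0..1}.
        E (gen_geodesic \<Omega> \<alpha>) \<le> ereal (1 - \<alpha>) * E \<mu>0 + ereal \<alpha> * E \<mu>1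
           - ereal (\<alpha> * (1 - \<alpha>) * lam / 2) * enn2ereal (W2_plan_sq \<Omega>))"

definition dom_closure :: "'a::euclidean_space measure \<Rightarrow> ('a measure \<Rightarrow> ereal) \<Rightarrow> 'a measure set" where
  "dom_closure \<omega>0 E = {\<mu>\<in>P2 \<omega>0. \<exists>\<mu>s. (\<forall>n. \<mu>s n \<in> P2 \<omega>0 \<and> E (\<mu>s n) < \<infinity>) \<and>
      ((\<lambda>n. W2 (\<mu>s n) \<mu>) \<longlongrightarrow> 0) sequentially}"

definition JKO_obj :: "('a::euclidean_space measure \<Rightarrow> ereal) \<Rightarrow> real \<Rightarrow> 'a measure \<Rightarrow> 'a measure \<Rightarrow> ereal" where
  "JKO_obj E \<tau> \<mu> \<nu> = ereal (1 / (2 * \<tau>)) * enn2ereal ((W2 \<mu> \<nu>)\<^sup>2) + E \<nu>"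

definition resolvent :: "'a::euclidean_space measure \<Rightarrow> ('a measure \<Rightarrow> ereal) \<Rightarrow> real \<Rightarrow> 'a measure \<Rightarrow> 'a measure" where
  "resolvent \<omega>0 E \<tau> \<mu> = (THE \<nu>. \<nu> \<in> P2 \<omega>0 \<and> (\<forall>\<nu>'\<in>P2 \<omega>0. JKO_obj E \<tau> \<mu> \<nu> \<le> JKO_obj E \<tau> \<mu> \<nu>'))"

end

theory Submission
  imports Defs
begin

text \<open>If \<open>\<nu>\<close> minimizes \<open>W\<^sup>2(\<mu>, \<cdot>) / (2 \<tau>) + E\<close> and \<open>v\<close> lies at time \<open>h / \<tau>\<close> on a geodesic from
  \<open>\<nu>\<close> to \<open>\<mu>\<close>, then the triangle inequality through \<open>v\<close> and convexity of the square give
  \<open>W\<^sup>2(\<mu>, \<rho>) / (2 \<tau>) \<le> W\<^sup>2(\<mu>, v) / (2 (\<tau> - h)) + W\<^sup>2(v, \<rho>) / (2 h)\<close> for every \<open>\<rho>\<close>, with equality for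
  \<open>\<rho> = \<nu>\<close>; hence \<open>\<nu>\<close> also minimizes \<open>W\<^sup>2(v, \<cdot>) / (2 h) + E\<close>.  Minimizers are unique because the
  objective is strongly convex along generalized geodesics based at \<open>\<mu>\<close>, and the same strong
  convexity makes minimizing sequences Cauchy, so existence reduces to completeness of the
  Wasserstein space.  Neither the triangle inequality nor completeness needs disintegration: a
  coupling conditioned on small cells of its first coordinate yields an explicit kernel that
  transports exactly and is optimal up to any prescribed error.  A Markov chain with such kernels,
  whose laws are the terms of a fast Cauchy sequence, converges almost surely and in mean square,
  and the law of its limit is the limit of the sequence.\<close>

section \<open>Transport kernels and the triangle inequality\<close>

text \<open>Couplings and plans carry the Borel sigma-algebra of the product type. Second
  countability identifies it with the product sigma-algebra, so the projections become available to
  \<open>measurable\<close>.\<close>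

lemma borel_measurable_fst [measurable (raw)]:
  fixes f :: "'c \<Rightarrow> 'a::second_countable_topology \<times> 'b::second_countable_topology"
  assumes "f \<in> borel_measurable M"
  shows "(\<lambda>x. fst (f x)) \<in> borel_measurable M"
  using assms by (auto simp flip: borel_prod)

lemma borel_measurable_snd [measurable (raw)]:
  fixes f :: "'c \<Rightarrow> 'a::second_countable_topology \<times> 'b::second_countable_topology"
  assumes "f \<in> borel_measurable M"
  shows "(\<lambda>x. snd (f x)) \<in> borel_measurable M"
  using assms by (auto simp flip: borel_prod)

lemma emeasure_distr_nn_integral:
  assumes "f \<in> M \<rightarrow>\<^sub>M N" and "X \<in> sets N"
  shows "emeasure (distr M N f) X = (\<integral>\<^sup>+ w. indicator X (f w) \<partial>M)"
proof -
  have "emeasure (distr M N f) X = (\<integral>\<^sup>+ y. indicator X y \<partial>distr M N f)"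
    using assms by simp
  also have "\<dots> = (\<integral>\<^sup>+ w. indicator X (f w) \<partial>M)"
    using assms by (intro nn_integral_distr) auto
  finally show ?thesis .
qed

section \<open>Couplings and elementary properties of the squared distance\<close>

lemma prob_borelD:
  assumes "prob_borel \<mu>"
  shows "prob_space \<mu>" and "sets \<mu> = sets borel" and "space \<mu> = UNIV"
  using assms sets_eq_imp_space_eq[of \<mu> borel] by (auto simp: prob_borel_def)

lemma prob_borel_distr:
  assumes "prob_space M" and "X \<in> M \<rightarrow>\<^sub>M (borel :: 'a::euclidean_space measure)"
  shows "prob_borel (distr M borel X)"
  using assms by (auto simp: prob_borel_def intro: prob_space.prob_space_distr)

lemma couplings_prob_borel:
  assumes "\<gamma> \<in> couplings \<mu> \<nu>"
  shows "prob_borel \<mu>" and "prob_borel \<nu>"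
proof -
  have g: "prob_space \<gamma>" "sets \<gamma> = sets borel" "\<mu> = distr \<gamma> borel fst" "\<nu> = distr \<gamma> borel snd"
    using assms by (auto simp: couplings_def)
  have m: "fst \<in> \<gamma> \<rightarrow>\<^sub>M borel" "snd \<in> \<gamma> \<rightarrow>\<^sub>M borel"
    unfolding measurable_cong_sets[OF g(2) refl] by measurable
  show "prob_borel \<mu>" "prob_borel \<nu>"
    unfolding g(3,4) by (rule prob_borel_distr[OF g(1)] m)+
qed

text \<open>The joint law of \<open>X\<close> and \<open>Y\<close> is a coupling. Upper bounds on
  the distance are obtained below by realizing both measures on one probability space.\<close>

lemma W2sq_le_distr:
  fixes X Y :: "'b \<Rightarrow> 'a::euclidean_space"
  assumes "prob_space M" and [measurable]: "X \<in> M \<rightarrow>\<^sub>M borel" "Y \<in> M \<rightarrow>\<^sub>M borel"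
  shows "W2sq (distr M borel X) (distr M borel Y) \<le> (\<integral>\<^sup>+ w. ennreal ((norm (X w - Y w))\<^sup>2) \<partial>M)"
proof -
  let ?\<gamma> = "distr M borel (\<lambda>w. (X w, Y w))"
  have [measurable]: "(\<lambda>w. (X w, Y w)) \<in> M \<rightarrow>\<^sub>M borel"
    by (simp add: borel_prod[symmetric])
  have \<gamma>: "?\<gamma> \<in> couplings (distr M borel X) (distr M borel Y)"
    using assms(1) by (auto simp: couplings_def distr_distr comp_def intro: prob_space.prob_space_distr)
  have "transport_cost ?\<gamma> = (\<integral>\<^sup>+ w. ennreal ((norm (X w - Y w))\<^sup>2) \<partial>M)"
    unfolding transport_cost_def by (subst nn_integral_distr) auto
  then show ?thesis
    using INF_lower[OF \<gamma>, of transport_cost] by (simp add: W2sq_def)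
qed

lemma W2sq_refl:
  assumes "prob_borel \<mu>" shows "W2sq \<mu> \<mu> = 0"
proof -
  have m: "(\<lambda>x. x) \<in> \<mu> \<rightarrow>\<^sub>M borel"
    unfolding measurable_cong_sets[OF prob_borelD(2)[OF assms] refl] by measurable
  have d: "distr \<mu> borel (\<lambda>x. x) = \<mu>"
    using prob_borelD(2)[OF assms] by (simp add: distr_id2)
  show ?thesis
    using W2sq_le_distr[OF prob_borelD(1)[OF assms] m m] unfolding d by simp
qed

lemma W2sq_commute: "W2sq \<mu> \<nu> = W2sq \<nu> (\<mu> :: 'a::euclidean_space measure)"
proof -
  have "W2sq \<nu> \<mu> \<le> W2sq \<mu> \<nu>" for \<mu> \<nu> :: "'a measure"
    unfolding W2sq_def[of \<mu> \<nu>]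
  proof (rule INF_greatest)
    fix \<gamma> assume "\<gamma> \<in> couplings \<mu> \<nu>"
    then have g: "prob_space \<gamma>" "sets \<gamma> = sets borel" "\<mu> = distr \<gamma> borel fst" "\<nu> = distr \<gamma> borel snd"
      by (auto simp: couplings_def)
    have m: "fst \<in> \<gamma> \<rightarrow>\<^sub>M borel" "snd \<in> \<gamma> \<rightarrow>\<^sub>M borel"
      unfolding measurable_cong_sets[OF g(2) refl] by measurable
    show "W2sq \<nu> \<mu> \<le> transport_cost \<gamma>"
      using W2sq_le_distr[OF g(1) m(2,1)] by (simp add: g(3,4)[symmetric] transport_cost_def norm_minus_commute)
  qed
  then show ?thesis by (intro antisym)
qed

lemma W2_power2: "(W2 \<mu> \<nu>)\<^sup>2 = W2sq \<mu> \<nu>"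
  by (cases "W2sq \<mu> \<nu>") (auto simp: W2_def ennreal_power)

lemma W2_less_top_iff: "W2 \<mu> \<nu> < \<top> \<longleftrightarrow> W2sq \<mu> \<nu> < \<top>"
  by (auto simp: W2_def less_top)

text \<open>Triangle inequality combined with Young's inequality. The free weight \<open>s\<close>
  lets all later estimates stay with squared distances: a small \<open>s\<close> makes the first
  factor almost 1, and a suitable \<open>s\<close> makes the bound an equality on a segment.\<close>

lemma norm_diff_sq_le:
  fixes x y z :: "'a::real_normed_vector"
  assumes "s > 0"
  shows "(norm (x - z))\<^sup>2 \<le> (1 + s) * (norm (x - y))\<^sup>2 + (1 + 1 / s) * (norm (y - z))\<^sup>2"
proof -
  let ?a = "norm (x - y)" and ?b = "norm (y - z)"
  have "0 \<le> (s * ?a - ?b)\<^sup>2 / s"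
    using assms by simp
  also have "\<dots> = s * ?a\<^sup>2 + ?b\<^sup>2 / s - 2 * ?a * ?b"
    using assms by (simp add: field_simps power2_eq_square)
  finally have "(?a + ?b)\<^sup>2 \<le> (1 + s) * ?a\<^sup>2 + (1 + 1 / s) * ?b\<^sup>2"
    by (simp add: algebra_simps power2_eq_square)
  moreover have "(norm (x - z))\<^sup>2 \<le> (?a + ?b)\<^sup>2"
    using norm_triangle_ineq[of "x - y" "y - z"] by (intro power_mono) auto
  ultimately show ?thesis by linarith
qed

text \<open>A point is labelled by the first member of a dense sequence that lies within half of
  \<epsilon>; equal labels then mean a common nearby centre.\<close>

lemma countable_small_partition:
  fixes \<epsilon> :: real
  assumes "\<epsilon> > 0"
  obtains q :: "'a::euclidean_space \<Rightarrow> nat"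
  where "q \<in> borel \<rightarrow>\<^sub>M count_space UNIV" and "\<And>x y. q x = q y \<Longrightarrow> norm (x - y) < \<epsilon>"
proof -
  obtain D :: "'a set" where D: "countable D" "\<And>X. open X \<Longrightarrow> X \<noteq> {} \<Longrightarrow> \<exists>d\<in>D. d \<in> X"
    using countable_dense_setE by metis
  define d where "d = from_nat_into D"
  define q where "q x = (LEAST n. dist x (d n) < \<epsilon> / 2)" for x
  have ex: "\<exists>n. dist x (d n) < \<epsilon> / 2" for x
    using D(2)[of "ball x (\<epsilon> / 2)"] assms from_nat_into_surj[OF D(1)] by (force simp: d_def)
  have near: "dist x (d (q x)) < \<epsilon> / 2" for x
    unfolding q_def using ex by (rule LeastI_ex)
  show thesis
  proof
    show "q \<in> borel \<rightarrow>\<^sub>M count_space UNIV"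
      unfolding q_def by measurable
    show "norm (x - y) < \<epsilon>" if "q x = q y" for x y
      using near[of x] near[of y] that by (smt (verit) dist_norm dist_triangle_half_l field_sum_of_halves)
  qed
qed

text \<open>Stands in for disintegration. A nearly optimal coupling is conditioned on the cell of
  its first coordinate, and \<open>K y\<close> is the second marginal of the result. Averaging over
  the cells restores the coupling, so the target is hit exactly. The conditioned first coordinate
  differs from \<open>y\<close> by less than the cell size, which costs only a small error.\<close>

lemma transport_kernel:
  fixes b c :: "'a::euclidean_space measure"
  assumes "W2sq b c < C"
  obtains K where "K \<in> borel \<rightarrow>\<^sub>M prob_algebra borel" and "b \<bind> K = c"
    and "(\<integral>\<^sup>+ y. \<integral>\<^sup>+ z. ennreal ((norm (y - z))\<^sup>2) \<partial>K y \<partial>b) \<le> C"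
proof -
  obtain \<gamma> where \<gamma>: "\<gamma> \<in> couplings b c" and cost: "transport_cost \<gamma> < C"
    using assms unfolding W2sq_def INF_less_iff by blast
  then have g: "prob_space \<gamma>" "b = distr \<gamma> borel fst" "c = distr \<gamma> borel snd"
    and [measurable_cong]: "sets \<gamma> = sets borel"
    by (auto simp: couplings_def)
  interpret \<gamma>: prob_space \<gamma> by fact
  have sp: "space \<gamma> = UNIV" using \<open>sets \<gamma> = sets borel\<close> by (metis sets_eq_imp_space_eq space_borel)
  have b: "prob_space b" "sets b = sets borel" "space b = UNIV"
    using prob_borelD[OF couplings_prob_borel(1)[OF \<gamma>]] by auto
  note [measurable_cong] = b(2)
  obtain T where T: "transport_cost \<gamma> = ennreal T" "0 \<le> T"
    using cost by (cases "transport_cost \<gamma>") auto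
  \<comment> \<open>\<open>C\<close> may be infinite, so the room for error is fixed between two
    reals.\<close>
  obtain T' where T': "T < T'" "ennreal T' \<le> C"
  proof (cases C)
    case (real r)
    then show ?thesis using cost T that[of r] by (auto simp: ennreal_less_iff)
  next
    case top
    then show ?thesis using that[of "T + 1"] by auto
  qed
  obtain s where s: "s > 0" "(1 + s) * T < T'"
  proof -
    have "((\<lambda>s. (1 + s) * T) \<longlongrightarrow> (1 + 0) * T) (at_right 0)"
      by (intro tendsto_intros)
    then have "eventually (\<lambda>s. (1 + s) * T < T') (at_right 0)"
      using T'(1) by (auto dest: order_tendstoD)
    then have "eventually (\<lambda>s. (1 + s) * T < T' \<and> s > 0) (at_right 0)"
      by (intro eventually_conj eventually_at_right_less)
    then show ?thesis
      using that by (metis (no_types, lifting) eventually_happens' trivial_limit_at_right_real)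
  qed
  \<comment> \<open>The cell size that uses up exactly what \<open>T'\<close> leaves after the
    weighted cost \<open>(1 + s) * T\<close>.\<close>
  define \<epsilon> where "\<epsilon> = sqrt ((T' - (1 + s) * T) / (1 + 1 / s))"
  have e: "\<epsilon> > 0" "(1 + s) * T + (1 + 1 / s) * \<epsilon>\<^sup>2 = T'"
    using s add_pos_pos[of 1 "1 / s"] by (auto simp: \<epsilon>_def)
  obtain q :: "'a \<Rightarrow> nat" where [measurable]: "q \<in> borel \<rightarrow>\<^sub>M count_space UNIV"
    and q: "\<And>x y. q x = q y \<Longrightarrow> norm (x - y) < \<epsilon>"
    using countable_small_partition[OF e(1)] by metis
  define A where "A i = {p :: 'a \<times> 'a. q (fst p) = i}" for i
  have A[measurable]: "A i \<in> sets borel" for i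
    unfolding A_def by measurable
  \<comment> \<open>Conditioning on a null cell is meaningless; the default \<gamma> keeps every
    \<open>U i\<close> a probability measure, so that \<open>K\<close> is a kernel
    everywhere.\<close>
  define U where "U i = (if emeasure \<gamma> (A i) = 0 then \<gamma> else uniform_measure \<gamma> (A i))" for i
  have U: "prob_space (U i)" "sets (U i) = sets borel" "space (U i) = UNIV" for i
    using g(1) sp \<open>sets \<gamma> = sets borel\<close>
    by (auto simp: U_def intro!: prob_space_uniform_measure)
  note [measurable_cong] = U(2)
  have eb: "emeasure b {x. q x = i} = emeasure \<gamma> (A i)" for i
  proof -
    have "{x. q x = i} \<in> sets borel" by measurable
    then show ?thesis
      unfolding g(2) by (subst emeasure_distr) (auto simp: A_def sp intro!: arg_cong[where f="emeasure \<gamma>"])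
  qed
  \<comment> \<open>Law of total probability over the countably many cells: a cell drawn from
    \<open>b\<close>, then a pair from \<gamma> conditioned on that cell, has law \<gamma>.\<close>
  have total: "(\<integral>\<^sup>+ x. \<integral>\<^sup>+ p. f p \<partial>U (q x) \<partial>b) = (\<integral>\<^sup>+ p. f p \<partial>\<gamma>)"
    if [measurable]: "f \<in> borel_measurable borel" for f :: "'a \<times> 'a \<Rightarrow> ennreal"
  proof -
    have piece: "(\<integral>\<^sup>+ p. f p \<partial>U i) * emeasure b {x. q x = i} = (\<integral>\<^sup>+ p. f p * indicator (A i) p \<partial>\<gamma>)" for i
    proof (cases "emeasure \<gamma> (A i) = 0")
      case True
      then have "AE p in \<gamma>. p \<notin> A i"
        by (intro AE_I[of _ _ "A i"]) auto
      then have "(\<integral>\<^sup>+ p. f p * indicator (A i) p \<partial>\<gamma>) = (\<integral>\<^sup>+ p. 0 \<partial>\<gamma>)"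
        by (intro nn_integral_cong_AE) auto
      then show ?thesis using True by (simp add: eb)
    next
      case False
      then show ?thesis
        by (simp add: eb U_def nn_integral_uniform_measure ennreal_divide_times
            ennreal_times_divide[symmetric] \<gamma>.emeasure_eq_measure ennreal_divide_self)
    qed
    have "(\<integral>\<^sup>+ x. \<integral>\<^sup>+ p. f p \<partial>U (q x) \<partial>b)
        = (\<integral>\<^sup>+ x. (\<Sum>i. (\<integral>\<^sup>+ p. f p \<partial>U i) * indicator {x. q x = i} x) \<partial>b)"
    proof (rule nn_integral_cong)
      fix x
      have "(\<Sum>i. (\<integral>\<^sup>+ p. f p \<partial>U i) * indicator {x. q x = i} x)
          = (\<Sum>i\<in>{q x}. (\<integral>\<^sup>+ p. f p \<partial>U i) * indicator {x. q x = i} x)"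
        by (rule suminf_finite) auto
      then show "(\<integral>\<^sup>+ p. f p \<partial>U (q x)) = (\<Sum>i. (\<integral>\<^sup>+ p. f p \<partial>U i) * indicator {x. q x = i} x)"
        by simp
    qed
    also have "\<dots> = (\<Sum>i. \<integral>\<^sup>+ x. (\<integral>\<^sup>+ p. f p \<partial>U i) * indicator {x. q x = i} x \<partial>b)"
      by (rule nn_integral_suminf) measurable
    also have "\<dots> = (\<Sum>i. (\<integral>\<^sup>+ p. f p \<partial>U i) * emeasure b {x. q x = i})"
      by (intro suminf_cong nn_integral_cmult_indicator) measurable
    also have "\<dots> = (\<Sum>i. \<integral>\<^sup>+ p. f p * indicator (A i) p \<partial>\<gamma>)"
      by (simp add: piece)
    also have "\<dots> = (\<integral>\<^sup>+ p. (\<Sum>i. f p * indicator (A i) p) \<partial>\<gamma>)"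
      by (rule nn_integral_suminf[symmetric]) measurable
    also have "\<dots> = (\<integral>\<^sup>+ p. f p \<partial>\<gamma>)"
    proof (rule nn_integral_cong)
      fix p
      have "(\<Sum>i. f p * indicator (A i) p) = (\<Sum>i\<in>{q (fst p)}. f p * indicator (A i) p)"
        by (rule suminf_finite) (auto simp: A_def)
      then show "(\<Sum>i. f p * indicator (A i) p) = f p"
        by (simp add: A_def)
    qed
    finally show ?thesis .
  qed
  define K where "K x = distr (U (q x)) borel snd" for x
  have K[measurable]: "K \<in> borel \<rightarrow>\<^sub>M prob_algebra borel"
  proof -
    have "(\<lambda>i. distr (U i) borel snd) \<in> count_space UNIV \<rightarrow>\<^sub>M prob_algebra borel"
      using U(1) by (auto simp: space_prob_algebra intro!: prob_space.prob_space_distr)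
    then show ?thesis unfolding K_def by measurable
  qed
  show thesis
  proof
    show "K \<in> borel \<rightarrow>\<^sub>M prob_algebra borel" by (rule K)
    have bK: "b \<in> space (prob_algebra borel)" using b by (simp add: space_prob_algebra)
    show "b \<bind> K = c"
    proof (rule measure_eqI)
      show "sets (b \<bind> K) = sets c"
        using sets_bind'[OF bK K] prob_borelD(2)[OF couplings_prob_borel(2)[OF \<gamma>]] by simp
      fix X assume "X \<in> sets (b \<bind> K)"
      then have [measurable]: "X \<in> sets borel" using sets_bind'[OF bK K] by simp
      have "emeasure (b \<bind> K) X = (\<integral>\<^sup>+ x. emeasure (K x) X \<partial>b)"
        by (rule emeasure_bind_prob_algebra[OF bK K]) fact
      also have "\<dots> = (\<integral>\<^sup>+ x. \<integral>\<^sup>+ p. indicator X (snd p) \<partial>U (q x) \<partial>b)"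
        unfolding K_def
        by (intro nn_integral_cong) (simp add: emeasure_distr_nn_integral)
      also have "\<dots> = (\<integral>\<^sup>+ p. indicator X (snd p) \<partial>\<gamma>)"
        by (rule total) measurable
      also have "\<dots> = emeasure c X"
        unfolding g(3) by (simp add: emeasure_distr_nn_integral)
      finally show "emeasure (b \<bind> K) X = emeasure c X" .
    qed
    let ?f = "\<lambda>p. ennreal (1 + s) * ennreal ((norm (fst p - snd p))\<^sup>2) + ennreal ((1 + 1 / s) * \<epsilon>\<^sup>2)"
    have "(\<integral>\<^sup>+ y. \<integral>\<^sup>+ z. ennreal ((norm (y - z))\<^sup>2) \<partial>K y \<partial>b) \<le> (\<integral>\<^sup>+ y. \<integral>\<^sup>+ p. ?f p \<partial>U (q y) \<partial>b)"
    proof (rule nn_integral_mono_AE)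
      \<comment> \<open>\<open>U (q y)\<close> is known to live on its cell only if that cell has
        positive mass; the null cells, being countably many, are discarded together.\<close>
      have "AE y in b. emeasure \<gamma> (A (q y)) \<noteq> 0"
      proof -
        have "AE y in b. q y \<noteq> i \<or> emeasure \<gamma> (A i) \<noteq> 0" for i
        proof (cases "emeasure \<gamma> (A i) = 0")
          case True
          then show ?thesis
            by (intro AE_I[of _ _ "{x. q x = i}"]) (auto simp: eb)
        qed auto
        then have "AE y in b. \<forall>i. q y \<noteq> i \<or> emeasure \<gamma> (A i) \<noteq> 0"
          by (rule AE_all_countable[THEN iffD2, rule_format])
        then show ?thesis by eventually_elim auto
      qed
      then show "AE y in b. (\<integral>\<^sup>+ z. ennreal ((norm (y - z))\<^sup>2) \<partial>K y) \<le> (\<integral>\<^sup>+ p. ?f p \<partial>U (q y))"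
      proof eventually_elim
        fix y assume y: "emeasure \<gamma> (A (q y)) \<noteq> 0"
        have "AE p in U (q y). p \<in> A (q y)"
        proof -
          have "AE p in uniform_measure \<gamma> (A (q y)). p \<in> A (q y)"
            by (rule AE_uniform_measureI) auto
          moreover have "U (q y) = uniform_measure \<gamma> (A (q y))"
            using y by (simp add: U_def)
          ultimately show ?thesis by metis
        qed
        then have "(\<integral>\<^sup>+ p. ennreal ((norm (y - snd p))\<^sup>2) \<partial>U (q y)) \<le> (\<integral>\<^sup>+ p. ?f p \<partial>U (q y))"
        proof (intro nn_integral_mono_AE, eventually_elim)
          fix p assume "p \<in> A (q y)"
          then have "norm (fst p - y) < \<epsilon>" by (intro q) (simp add: A_def)
          then have "(norm (fst p - y))\<^sup>2 \<le> \<epsilon>\<^sup>2" by (intro power_mono) auto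
          then have "(1 + 1 / s) * (norm (fst p - y))\<^sup>2 \<le> (1 + 1 / s) * \<epsilon>\<^sup>2"
            using s by (intro mult_left_mono) auto
          then have "(norm (y - snd p))\<^sup>2 \<le> (1 + s) * (norm (fst p - snd p))\<^sup>2 + (1 + 1 / s) * \<epsilon>\<^sup>2"
            using norm_diff_sq_le[OF s(1), of "snd p" y "fst p"] by (simp add: norm_minus_commute)
          then show "ennreal ((norm (y - snd p))\<^sup>2) \<le> ?f p"
            using s by (simp flip: ennreal_mult ennreal_plus)
        qed
        then show "(\<integral>\<^sup>+ z. ennreal ((norm (y - z))\<^sup>2) \<partial>K y) \<le> (\<integral>\<^sup>+ p. ?f p \<partial>U (q y))"
          unfolding K_def by (subst nn_integral_distr) auto
      qed
    qed
    also have "\<dots> = (\<integral>\<^sup>+ p. ?f p \<partial>\<gamma>)"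
      by (rule total) measurable
    also have "\<dots> = ennreal (1 + s) * transport_cost \<gamma> + ennreal ((1 + 1 / s) * \<epsilon>\<^sup>2)"
      unfolding transport_cost_def
      by (subst nn_integral_add) (simp_all add: nn_integral_cmult \<gamma>.emeasure_space_1)
    also have "\<dots> = ennreal T'"
      using s T(2) by (simp add: T(1) flip: e(2) ennreal_mult ennreal_plus)
    finally show "(\<integral>\<^sup>+ y. \<integral>\<^sup>+ z. ennreal ((norm (y - z))\<^sup>2) \<partial>K y \<partial>b) \<le> C"
      using T'(2) by (rule order_trans)
  qed
qed

text \<open>Gluing: a coupling of \<open>a\<close> and \<open>b\<close> is extended by a third
  coordinate drawn from an approximate kernel from \<open>b\<close> to \<open>c\<close>, and the
  pointwise weighted inequality is integrated. Infinite distances are allowed.\<close>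

lemma W2sq_triangle:
  fixes a b c :: "'a::euclidean_space measure"
  assumes ab: "prob_borel a" "prob_borel b" "prob_borel c" and s: "s > 0"
  shows "W2sq a c \<le> ennreal (1 + s) * W2sq a b + ennreal (1 + 1 / s) * W2sq b c"
proof -
  have bound: "W2sq a c \<le> ennreal (1 + s) * transport_cost \<gamma> + ennreal (1 + 1 / s) * C"
    if \<gamma>: "\<gamma> \<in> couplings a b" and C: "W2sq b c < C" for \<gamma> C
  proof -
    obtain K where K[measurable]: "K \<in> borel \<rightarrow>\<^sub>M prob_algebra borel" and bK: "b \<bind> K = c"
      and cost: "(\<integral>\<^sup>+ y. \<integral>\<^sup>+ z. ennreal ((norm (y - z))\<^sup>2) \<partial>K y \<partial>b) \<le> C"
      by (rule transport_kernel[OF C])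
    have g: "prob_space \<gamma>" "a = distr \<gamma> borel fst" "b = distr \<gamma> borel snd"
      and [measurable_cong]: "sets \<gamma> = sets borel"
      using \<gamma> by (auto simp: couplings_def)
    have \<gamma>P: "\<gamma> \<in> space (prob_algebra borel)" using g(1) \<open>sets \<gamma> = sets borel\<close> by (simp add: space_prob_algebra)
    have Kx: "prob_space (K x)" "sets (K x) = sets borel" for x
      using measurable_space[OF K, of x] by (auto simp: space_prob_algebra)
    note [measurable_cong] = Kx(2)
    have Ks[measurable]: "K \<in> borel \<rightarrow>\<^sub>M subprob_algebra borel"
      by (rule measurable_prob_algebraD[OF K])
    \<comment> \<open>The pair \<open>p\<close> is kept and \<open>z\<close> is drawn from its
      second coordinate alone; \<Gamma> is then the law of the glued triple.\<close>
    define L where "L p = distr (K (snd p)) borel (\<lambda>z. (p, z))" for p :: "'a \<times> 'a"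
    have L[measurable]: "L \<in> borel \<rightarrow>\<^sub>M prob_algebra borel"
      unfolding L_def by (rule measurable_distr_prob_space2[where M=borel]) measurable
    have Ls: "L \<in> \<gamma> \<rightarrow>\<^sub>M subprob_algebra borel"
      using measurable_prob_algebraD[OF L] by (simp add: measurable_cong_sets[OF \<open>sets \<gamma> = sets borel\<close> refl])
    define \<Gamma> where "\<Gamma> = \<gamma> \<bind> L"
    have \<Gamma>: "prob_space \<Gamma>" and [measurable_cong]: "sets \<Gamma> = sets borel"
      unfolding \<Gamma>_def using prob_space_bind'[OF \<gamma>P L] sets_bind'[OF \<gamma>P L] by auto
    have int: "(\<integral>\<^sup>+ w. f w \<partial>\<Gamma>) = (\<integral>\<^sup>+ p. \<integral>\<^sup>+ z. f (p, z) \<partial>K (snd p) \<partial>\<gamma>)"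
      if [measurable]: "f \<in> borel_measurable borel" for f :: "('a \<times> 'a) \<times> 'a \<Rightarrow> ennreal"
      unfolding \<Gamma>_def
      by (subst nn_integral_bind[OF _ Ls]) (auto simp: L_def nn_integral_distr)
    note [simp] = prob_space.emeasure_space_1[OF Kx(1)]
    have da: "distr \<Gamma> borel (\<lambda>w. fst (fst w)) = a"
    proof (rule measure_eqI)
      fix X assume "X \<in> sets (distr \<Gamma> borel (\<lambda>w. fst (fst w)))"
      then have [measurable]: "X \<in> sets borel" by simp
      show "emeasure (distr \<Gamma> borel (\<lambda>w. fst (fst w))) X = emeasure a X"
        unfolding g(2) by (simp add: emeasure_distr_nn_integral nn_integral_distr int)
    qed (simp add: g(2))
    have dc: "distr \<Gamma> borel snd = c"
    proof (rule measure_eqI)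
      fix X assume "X \<in> sets (distr \<Gamma> borel snd)"
      then have [measurable]: "X \<in> sets borel" by simp
      have "emeasure (distr \<Gamma> borel snd) X = (\<integral>\<^sup>+ y. \<integral>\<^sup>+ z. indicator X z \<partial>K y \<partial>b)"
        unfolding g(3) by (simp add: emeasure_distr_nn_integral nn_integral_distr int)
      also have "\<dots> = (\<integral>\<^sup>+ y. emeasure (K y) X \<partial>b)"
        by (simp add: Kx)
      also have "\<dots> = emeasure (b \<bind> K) X"
        using ab(2) by (intro emeasure_bind_prob_algebra[symmetric, OF _ K])
          (auto simp: space_prob_algebra prob_borel_def)
      finally show "emeasure (distr \<Gamma> borel snd) X = emeasure c X"
        by (simp add: bK)
    qed (use prob_borelD[OF ab(3)] in simp)
    have "W2sq a c \<le> (\<integral>\<^sup>+ w. ennreal ((norm (fst (fst w) - snd w))\<^sup>2) \<partial>\<Gamma>)"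
      using W2sq_le_distr[OF \<Gamma>, of "\<lambda>w. fst (fst w)" snd] unfolding da dc by measurable
    also have "\<dots> \<le> (\<integral>\<^sup>+ w. ennreal (1 + s) * ennreal ((norm (fst (fst w) - snd (fst w)))\<^sup>2)
        + ennreal (1 + 1 / s) * ennreal ((norm (snd (fst w) - snd w))\<^sup>2) \<partial>\<Gamma>)"
      using s by (intro nn_integral_mono) (simp add: norm_diff_sq_le flip: ennreal_mult ennreal_plus)
    also have "\<dots> = ennreal (1 + s) * (\<integral>\<^sup>+ w. ennreal ((norm (fst (fst w) - snd (fst w)))\<^sup>2) \<partial>\<Gamma>)
        + ennreal (1 + 1 / s) * (\<integral>\<^sup>+ w. ennreal ((norm (snd (fst w) - snd w))\<^sup>2) \<partial>\<Gamma>)"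
      by (subst nn_integral_add) (simp_all add: nn_integral_cmult)
    also have "(\<integral>\<^sup>+ w. ennreal ((norm (fst (fst w) - snd (fst w)))\<^sup>2) \<partial>\<Gamma>) = transport_cost \<gamma>"
      by (simp add: int transport_cost_def)
    also have "(\<integral>\<^sup>+ w. ennreal ((norm (snd (fst w) - snd w))\<^sup>2) \<partial>\<Gamma>)
        = (\<integral>\<^sup>+ y. \<integral>\<^sup>+ z. ennreal ((norm (y - z))\<^sup>2) \<partial>K y \<partial>b)"
    proof -
      have "(\<lambda>y. \<integral>\<^sup>+ z. ennreal ((norm (y - z))\<^sup>2) \<partial>K y) \<in> borel_measurable borel"
        by (rule nn_integral_measurable_subprob_algebra2[OF _ Ks]) measurable
      then show ?thesis
        unfolding g(3) by (simp add: int nn_integral_distr)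
    qed
    finally show ?thesis
      using cost by (meson add_left_mono dual_order.trans mult_left_mono zero_le)
  qed
  show ?thesis
  proof (cases "W2sq b c = \<top> \<or> W2sq a b = \<top>")
    \<comment> \<open>Both weights are positive, so an infinite distance makes the right-hand side
      infinite.\<close>
    case True
    then show ?thesis using s by (auto simp: ennreal_mult_top add_pos_pos)
  next
    case False
    then obtain x y where xy: "W2sq a b = ennreal x" "W2sq b c = ennreal y" "0 \<le> x" "0 \<le> y"
      by (metis ennreal_cases)
    show ?thesis
    proof (rule ennreal_le_epsilon)
      fix e :: real assume e: "0 < e"
      \<comment> \<open>The slack granted to each of the two distances, so that the weighted slacks
        add up to \<open>e\<close>.\<close>
      define d where "d = e / ((1 + s) + (1 + 1 / s))"
      have pos: "(1 + s) + (1 + 1 / s) > 0"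
        using s by (intro add_pos_pos) auto
      have d: "d > 0" "(1 + s) * d + (1 + 1 / s) * d = e"
        using e pos unfolding d_def distrib_right[symmetric] by auto
      have "W2sq a b < ennreal (x + d)" "W2sq b c < ennreal (y + d)"
        using xy d by (auto simp: ennreal_less_iff)
      then obtain \<gamma> where "\<gamma> \<in> couplings a b" "transport_cost \<gamma> < ennreal (x + d)"
        unfolding W2sq_def INF_less_iff by auto
      then have "W2sq a c \<le> ennreal (1 + s) * ennreal (x + d) + ennreal (1 + 1 / s) * ennreal (y + d)"
        using bound[OF _ \<open>W2sq b c < _\<close>] by (meson add_right_mono dual_order.trans mult_left_mono order_less_imp_le zero_le)
      also have "\<dots> = ennreal ((1 + s) * x + (1 + 1 / s) * y + e)"
        using s xy d by (simp flip: ennreal_mult ennreal_plus d(2)) (simp add: algebra_simps add_divide_distrib)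
      also have "\<dots> = ennreal (1 + s) * W2sq a b + ennreal (1 + 1 / s) * W2sq b c + ennreal e"
        using s xy e by (simp flip: ennreal_mult ennreal_plus)
      finally show "W2sq a c \<le> ennreal (1 + s) * W2sq a b + ennreal (1 + 1 / s) * W2sq b c + ennreal e" .
    qed
  qed
qed

section \<open>Completeness\<close>

text \<open>The Ionescu-Tulcea construction with transitions that look only at the last coordinate.
  The Markov property is recorded as a formula for the joint law of two consecutive
  coordinates.\<close>

lemma markov_chain_exists:
  fixes \<nu>\<^sub>0 :: "'a measure" and K :: "nat \<Rightarrow> 'a \<Rightarrow> 'a measure"
  assumes \<nu>\<^sub>0: "\<nu>\<^sub>0 \<in> space (prob_algebra S)"
    and K: "\<And>n. K n \<in> S \<rightarrow>\<^sub>M prob_algebra S"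
  obtains Q :: "(nat \<Rightarrow> 'a) measure"
  where "prob_space Q" and "sets Q = sets (PiM UNIV (\<lambda>_. S))"
    and "distr Q S (\<lambda>\<omega>. \<omega> 0) = \<nu>\<^sub>0"
    and "\<forall>n. \<forall>f\<in>borel_measurable (S \<Otimes>\<^sub>M S).
      (\<integral>\<^sup>+ \<omega>. f (\<omega> n, \<omega> (Suc n)) \<partial>Q) = (\<integral>\<^sup>+ \<omega>. \<integral>\<^sup>+ z. f (\<omega> n, z) \<partial>K n (\<omega> n) \<partial>Q)"
proof -
  \<comment> \<open>\<open>P i\<close> is the law of coordinate \<open>i\<close> given the
    coordinates below \<open>i\<close>; hence \<open>K n\<close> produces coordinate
    \<open>Suc n\<close>.\<close>
  define P where "P i \<omega> = (case i of 0 \<Rightarrow> \<nu>\<^sub>0 | Suc n \<Rightarrow> K n (\<omega> n))" for i and \<omega> :: "nat \<Rightarrow> 'a"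
  have Ks[measurable]: "K n \<in> S \<rightarrow>\<^sub>M subprob_algebra S" for n
    by (rule measurable_prob_algebraD[OF K])
  have \<nu>\<^sub>0': "prob_space \<nu>\<^sub>0" "sets \<nu>\<^sub>0 = sets S"
    using \<nu>\<^sub>0 by (auto simp: space_prob_algebra)
  have PM: "P i \<in> PiM {0..<i} (\<lambda>_. S) \<rightarrow>\<^sub>M subprob_algebra S" for i
  proof (cases i)
    case 0
    then show ?thesis
      using \<nu>\<^sub>0' by (simp add: P_def[abs_def] space_subprob_algebra prob_space_imp_subprob_space)
  next
    case (Suc n)
    have "(\<lambda>\<omega>. K n (\<omega> n)) \<in> PiM {0..<Suc n} (\<lambda>_. S) \<rightarrow>\<^sub>M subprob_algebra S"
      by (rule measurable_compose[OF _ Ks]) simp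
    then show ?thesis by (simp add: Suc P_def[abs_def])
  qed
  have PP: "prob_space (P i x)" if "x \<in> space (PiM {0..<i} (\<lambda>_. S))" for i x
  proof (cases i)
    case 0
    then show ?thesis using \<nu>\<^sub>0' by (simp add: P_def)
  next
    case (Suc n)
    then have "x n \<in> space S" using that by (auto simp: space_PiM PiE_iff)
    then show ?thesis
      using measurable_space[OF K, of "x n" n] by (simp add: Suc P_def space_prob_algebra)
  qed
  interpret Ionescu_Tulcea P "\<lambda>_. S"
    by (rule Ionescu_Tulcea.intro) (rule PM PP, assumption?)+
  \<comment> \<open>The law of the first \<open>n\<close> coordinates, started from the empty
    history.\<close>
  let ?C = "\<lambda>n. C 0 n (\<lambda>_. undefined)"
  have u: "(\<lambda>_. undefined) \<in> space (PiM {0..<0::nat} (\<lambda>_. S))"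
    by (simp add: space_PiM)
  \<comment> \<open>\<open>CI\<close> is the projective family behind the limit measure; on initial
    segments it has to be matched with the measures built step by step.\<close>
  have CI: "CI {0..<n} = ?C n" for n
  proof (rule measure_eqI)
    show s: "sets (CI {0..<n}) = sets (?C n)"
      using sets_C[OF u, of n] by (simp add: CI_def)
    fix X assume X: "X \<in> sets (CI {0..<n})"
    then have X': "X \<in> sets (PiM {0..<n} (\<lambda>_. S))" by (simp add: CI_def)
    then have "PF.emb {0..<n} {0..<n} X = X"
      using sets.sets_into_space[OF X'] by (intro prod_emb_id) (simp add: space_PiM)
    then show "emeasure (CI {0..<n}) X = emeasure (?C n) X"
      using emeasure_CI[of "{0..<n}" n X] X' by simp
  qed
  define Q where "Q = PF.lim"
  have sQ[measurable_cong]: "sets Q = sets (PiM UNIV (\<lambda>_. S))"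
    by (simp add: Q_def)
  have int: "(\<integral>\<^sup>+ \<omega>. f (restrict \<omega> {0..<n}) \<partial>Q) = (\<integral>\<^sup>+ \<omega>. f \<omega> \<partial>?C n)"
    if [measurable]: "f \<in> borel_measurable (PiM {0..<n} (\<lambda>_. S))" for f :: "_ \<Rightarrow> ennreal" and n
  proof -
    have m: "(\<lambda>\<omega>. restrict \<omega> {0..<n}) \<in> Q \<rightarrow>\<^sub>M PiM {0..<n} (\<lambda>_. S)"
      unfolding measurable_cong_sets[OF sQ refl] by (rule measurable_restrict_subset) simp
    have "?C n = distr Q (PiM {0..<n} (\<lambda>_. S)) (\<lambda>\<omega>. restrict \<omega> {0..<n})"
      unfolding CI[symmetric] Q_def by (rule distr_lim[symmetric]) simp
    then show ?thesis
      using nn_integral_distr[OF m, of f] by simp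
  qed
  have step: "(\<integral>\<^sup>+ \<omega>. f \<omega> \<partial>?C (Suc n)) = (\<integral>\<^sup>+ \<omega>. \<integral>\<^sup>+ z. f (fun_upd \<omega> n z) \<partial>P n \<omega> \<partial>?C n)"
    if [measurable]: "f \<in> borel_measurable (PiM {0..<Suc n} (\<lambda>_. S))" for f :: "_ \<Rightarrow> ennreal" and n
  proof -
    have sC: "sets (?C n) = sets (PiM {0..<n} (\<lambda>_. S))" "space (?C n) = space (PiM {0..<n} (\<lambda>_. S))"
      using sets_C[OF u, of n] space_C[OF u, of n] by simp_all
    have "eP n \<in> ?C n \<rightarrow>\<^sub>M subprob_algebra (PiM {0..<Suc n} (\<lambda>_. S))"
      unfolding measurable_cong_sets[OF sC(1) refl] by (rule measurable_eP)
    then have "(\<integral>\<^sup>+ \<omega>. f \<omega> \<partial>?C (Suc n)) = (\<integral>\<^sup>+ \<omega>. \<integral>\<^sup>+ \<omega>'. f \<omega>' \<partial>eP n \<omega> \<partial>?C n)"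
      by (simp add: nn_integral_bind[OF that])
    also have "\<dots> = (\<integral>\<^sup>+ \<omega>. \<integral>\<^sup>+ z. f (fun_upd \<omega> n z) \<partial>P n \<omega> \<partial>?C n)"
      by (intro nn_integral_cong nn_integral_eP that) (simp add: sC)
    finally show ?thesis .
  qed
  show thesis
  proof
    \<comment> \<open>Total mass is already visible after projecting to the empty index set.\<close>
    show "prob_space Q"
    proof (rule prob_space_distrD)
      show "(\<lambda>\<omega>. restrict \<omega> {}) \<in> Q \<rightarrow>\<^sub>M PiM {} (\<lambda>_. S)"
        by (simp add: measurable_cong_sets[OF sQ refl] measurable_restrict_subset)
      show "prob_space (distr Q (PiM {} (\<lambda>_. S)) (\<lambda>\<omega>. restrict \<omega> {}))"
        unfolding Q_def by (subst distr_lim) (auto intro: PF.prob_space_P)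
    qed
    show "sets Q = sets (PiM UNIV (\<lambda>_. S))" by (rule sQ)
    show "distr Q S (\<lambda>\<omega>. \<omega> 0) = \<nu>\<^sub>0"
    proof (rule measure_eqI)
      fix X assume "X \<in> sets (distr Q S (\<lambda>\<omega>. \<omega> 0))"
      then have X[measurable]: "X \<in> sets S" by simp
      have "emeasure (distr Q S (\<lambda>\<omega>. \<omega> 0)) X = (\<integral>\<^sup>+ \<omega>. indicator X (\<omega> 0) \<partial>Q)"
        by (intro emeasure_distr_nn_integral) measurable
      also have "\<dots> = (\<integral>\<^sup>+ \<omega>. indicator X (\<omega> 0) \<partial>?C (Suc 0))"
        using int[of "\<lambda>\<omega>. indicator X (\<omega> 0)" "Suc 0"] by simp
      also have "\<dots> = (\<integral>\<^sup>+ \<omega>. \<integral>\<^sup>+ z. indicator X z \<partial>\<nu>\<^sub>0 \<partial>?C 0)"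
        by (subst step) (simp_all add: P_def)
      also have "\<dots> = emeasure \<nu>\<^sub>0 X"
        using \<nu>\<^sub>0' u by (simp add: nn_integral_return)
      finally show "emeasure (distr Q S (\<lambda>\<omega>. \<omega> 0)) X = emeasure \<nu>\<^sub>0 X" .
    qed (simp add: \<nu>\<^sub>0')
    show "\<forall>n. \<forall>f\<in>borel_measurable (S \<Otimes>\<^sub>M S).
      (\<integral>\<^sup>+ \<omega>. f (\<omega> n, \<omega> (Suc n)) \<partial>Q) = (\<integral>\<^sup>+ \<omega>. \<integral>\<^sup>+ z. f (\<omega> n, z) \<partial>K n (\<omega> n) \<partial>Q)"
    proof (intro allI ballI)
      fix n and f :: "'a \<times> 'a \<Rightarrow> ennreal"
      assume f[measurable]: "f \<in> borel_measurable (S \<Otimes>\<^sub>M S)"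
      have [measurable]: "(\<lambda>y. \<integral>\<^sup>+ z. f (y, z) \<partial>K n y) \<in> borel_measurable S"
        by (rule nn_integral_measurable_subprob_algebra2[OF _ Ks]) measurable
      have c: "(\<lambda>\<omega>. \<omega> i) \<in> PiM {0..<m} (\<lambda>_. S) \<rightarrow>\<^sub>M S" if "i < m" for i m :: nat
        using that by (intro measurable_component_singleton) simp
      have [measurable]: "(\<lambda>\<omega>. f (\<omega> n, \<omega> (Suc n))) \<in> borel_measurable (PiM {0..<Suc (Suc n)} (\<lambda>_. S))"
        by (rule measurable_compose[OF _ f]) (intro measurable_Pair c; simp)
      have [measurable]: "(\<lambda>\<omega>. \<integral>\<^sup>+ z. f (\<omega> n, z) \<partial>K n (\<omega> n)) \<in> borel_measurable (PiM {0..<Suc n} (\<lambda>_. S))"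
        by (rule measurable_compose[of "\<lambda>\<omega>. \<omega> n"]) (auto intro!: c)
      have "(\<integral>\<^sup>+ \<omega>. f (\<omega> n, \<omega> (Suc n)) \<partial>Q) = (\<integral>\<^sup>+ \<omega>. f (\<omega> n, \<omega> (Suc n)) \<partial>?C (Suc (Suc n)))"
        using int[of "\<lambda>\<omega>. f (\<omega> n, \<omega> (Suc n))" "Suc (Suc n)"] by simp
      also have "\<dots> = (\<integral>\<^sup>+ \<omega>. \<integral>\<^sup>+ z. f (\<omega> n, z) \<partial>K n (\<omega> n) \<partial>?C (Suc n))"
        by (subst step) (simp_all add: P_def)
      also have "\<dots> = (\<integral>\<^sup>+ \<omega>. \<integral>\<^sup>+ z. f (\<omega> n, z) \<partial>K n (\<omega> n) \<partial>Q)"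
        using int[of "\<lambda>\<omega>. \<integral>\<^sup>+ z. f (\<omega> n, z) \<partial>K n (\<omega> n)" "Suc n"] by simp
      finally show "(\<integral>\<^sup>+ \<omega>. f (\<omega> n, \<omega> (Suc n)) \<partial>Q) = (\<integral>\<^sup>+ \<omega>. \<integral>\<^sup>+ z. f (\<omega> n, z) \<partial>K n (\<omega> n) \<partial>Q)" .
    qed
  qed
qed

text \<open>Each further step splits the remaining distance by \<open>norm_diff_sq_le\<close> with
  weight 1, which doubles the factor on everything that follows.\<close>

lemma norm_diff_sq_le_weighted_sum:
  fixes x :: "nat \<Rightarrow> 'a::real_normed_vector"
  shows "(norm (x n - x (n + m)))\<^sup>2 \<le> (\<Sum>k<m. 2 ^ Suc k * (norm (x (n + k) - x (Suc (n + k))))\<^sup>2)"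
proof (induction m arbitrary: n)
  case (Suc m)
  have "(norm (x n - x (n + Suc m)))\<^sup>2
      \<le> 2 * (norm (x n - x (Suc n)))\<^sup>2 + 2 * (norm (x (Suc n) - x (Suc n + m)))\<^sup>2"
    using norm_diff_sq_le[of 1 "x n" "x (n + Suc m)" "x (Suc n)"] by simp
  also have "\<dots> \<le> 2 * (norm (x n - x (Suc n)))\<^sup>2
      + 2 * (\<Sum>k<m. 2 ^ Suc k * (norm (x (Suc n + k) - x (Suc (Suc n + k))))\<^sup>2)"
    using Suc.IH[of "Suc n"] by simp
  also have "\<dots> = (\<Sum>k<Suc m. 2 ^ Suc k * (norm (x (n + k) - x (Suc (n + k))))\<^sup>2)"
    by (simp add: sum.lessThan_Suc_shift sum_distrib_left mult.assoc del: sum.lessThan_Suc)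
  finally show ?case .
qed simp

text \<open>In the full sum the increments after time \<open>n\<close> carry an additional factor
  \<open>2 ^ n\<close>. The squared distance from \<open>x n\<close> to any later term is therefore
  at most \<open>B / 2 ^ n\<close>.\<close>

lemma Cauchy_of_weighted_sums_bounded:
  fixes x :: "nat \<Rightarrow> 'a::real_normed_vector"
  assumes B: "\<And>m. (\<Sum>k<m. 2 ^ Suc k * (norm (x k - x (Suc k)))\<^sup>2) \<le> B"
  shows "Cauchy x"
  unfolding Cauchy_altdef2
proof (intro allI impI)
  fix e :: real assume e: "e > 0"
  have bound: "2 ^ n * (norm (x n - x (n + m)))\<^sup>2 \<le> B" for n m
  proof -
    have "2 ^ n * (norm (x n - x (n + m)))\<^sup>2
        \<le> 2 ^ n * (\<Sum>k<m. 2 ^ Suc k * (norm (x (n + k) - x (Suc (n + k))))\<^sup>2)"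
      by (intro mult_left_mono norm_diff_sq_le_weighted_sum) auto
    also have "\<dots> = (\<Sum>k<m. 2 ^ Suc (n + k) * (norm (x (n + k) - x (Suc (n + k))))\<^sup>2)"
      by (simp add: sum_distrib_left power_add mult_ac)
    also have "\<dots> \<le> (\<Sum>k<n. 2 ^ Suc k * (norm (x k - x (Suc k)))\<^sup>2)
        + (\<Sum>k<m. 2 ^ Suc (n + k) * (norm (x (n + k) - x (Suc (n + k))))\<^sup>2)"
      by (simp add: sum_nonneg)
    also have "\<dots> = (\<Sum>k<n + m. 2 ^ Suc k * (norm (x k - x (Suc k)))\<^sup>2)"
      by (induction m) simp_all
    finally show ?thesis using B[of "n + m"] by linarith
  qed
  have "(\<lambda>n. B / 2 ^ n) \<longlonglongrightarrow> 0"
    by (rule LIMSEQ_divide_realpow_zero) simp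
  then have "eventually (\<lambda>n. B / 2 ^ n < e\<^sup>2) sequentially"
    using e by (intro order_tendstoD(2)) auto
  then obtain N where N: "B / 2 ^ N < e\<^sup>2"
    by (auto simp: eventually_sequentially)
  show "\<exists>N. \<forall>n\<ge>N. dist (x n) (x N) < e"
  proof (intro exI[of _ N] allI impI)
    fix n assume "N \<le> n"
    then have "(norm (x N - x n))\<^sup>2 \<le> B / 2 ^ N"
      using bound[of N "n - N"] by (simp add: field_simps)
    then have "(norm (x N - x n))\<^sup>2 < e\<^sup>2" using N by linarith
    then show "dist (x n) (x N) < e"
      using e by (simp add: dist_norm norm_minus_commute power_less_imp_less_base)
  qed
qed

text \<open>All measures are realized as coordinate laws of one Markov chain with nearly optimal
  kernels. Pathwise convergence in the complete space \<open>'a\<close> then yields the limit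
  measure.\<close>

lemma W2sq_fast_Cauchy_convergent:
  fixes \<nu> :: "nat \<Rightarrow> 'a::euclidean_space measure"
  assumes \<nu>: "\<And>n. prob_borel (\<nu> n)"
    and fast: "\<And>n. W2sq (\<nu> n) (\<nu> (Suc n)) < ennreal ((1 / 8) ^ n)"
  obtains \<nu>' where "prob_borel \<nu>'" and "(\<lambda>n. W2sq (\<nu> n) \<nu>') \<longlonglongrightarrow> 0"
proof -
  have ex: "\<forall>n. \<exists>K. K \<in> borel \<rightarrow>\<^sub>M prob_algebra borel \<and> \<nu> n \<bind> K = \<nu> (Suc n) \<and>
      (\<integral>\<^sup>+ y. \<integral>\<^sup>+ z. ennreal ((norm (y - z))\<^sup>2) \<partial>K y \<partial>\<nu> n) \<le> ennreal ((1 / 8) ^ n)"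
  proof
    fix n
    obtain K where "K \<in> borel \<rightarrow>\<^sub>M prob_algebra borel" "\<nu> n \<bind> K = \<nu> (Suc n)"
      "(\<integral>\<^sup>+ y. \<integral>\<^sup>+ z. ennreal ((norm (y - z))\<^sup>2) \<partial>K y \<partial>\<nu> n) \<le> ennreal ((1 / 8) ^ n)"
      by (rule transport_kernel[OF fast[of n]])
    then show "\<exists>K. K \<in> borel \<rightarrow>\<^sub>M prob_algebra borel \<and> \<nu> n \<bind> K = \<nu> (Suc n) \<and>
      (\<integral>\<^sup>+ y. \<integral>\<^sup>+ z. ennreal ((norm (y - z))\<^sup>2) \<partial>K y \<partial>\<nu> n) \<le> ennreal ((1 / 8) ^ n)"
      by (intro exI[of _ K] conjI)
  qed
  obtain K where "\<forall>n. K n \<in> borel \<rightarrow>\<^sub>M prob_algebra borel \<and> \<nu> n \<bind> K n = \<nu> (Suc n) \<and>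
      (\<integral>\<^sup>+ y. \<integral>\<^sup>+ z. ennreal ((norm (y - z))\<^sup>2) \<partial>K n y \<partial>\<nu> n) \<le> ennreal ((1 / 8) ^ n)"
    by (rule exE[OF choice[OF ex]])
  then have K: "\<And>n. K n \<in> borel \<rightarrow>\<^sub>M prob_algebra borel"
    and \<nu>K: "\<And>n. \<nu> n \<bind> K n = \<nu> (Suc n)"
    and cost: "\<And>n. (\<integral>\<^sup>+ y. \<integral>\<^sup>+ z. ennreal ((norm (y - z))\<^sup>2) \<partial>K n y \<partial>\<nu> n) \<le> ennreal ((1 / 8) ^ n)"
    by (auto simp only:)
  have \<nu>P: "\<nu> n \<in> space (prob_algebra borel)" for n
    using \<nu>[of n] by (auto simp: space_prob_algebra prob_borel_def)
  have Ks: "K n \<in> borel \<rightarrow>\<^sub>M subprob_algebra borel" for n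
    by (rule measurable_prob_algebraD[OF K])
  have Kx: "sets (K n x) = sets borel" for n x
    using measurable_space[OF K, of x n] by (auto simp: space_prob_algebra)
  obtain Q :: "(nat \<Rightarrow> 'a) measure" where Q: "prob_space Q"
    and sQ[measurable_cong]: "sets Q = sets (PiM UNIV (\<lambda>_. borel))"
    and Q0: "distr Q borel (\<lambda>\<omega>. \<omega> 0) = \<nu> 0"
    and QS: "\<forall>n. \<forall>f\<in>borel_measurable (borel \<Otimes>\<^sub>M borel).
      (\<integral>\<^sup>+ \<omega>. f (\<omega> n, \<omega> (Suc n)) \<partial>Q) = (\<integral>\<^sup>+ \<omega>. \<integral>\<^sup>+ z. f (\<omega> n, z) \<partial>K n (\<omega> n) \<partial>Q)"
    by (rule markov_chain_exists[where K = K, OF \<nu>P[of 0] K])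
  \<comment> \<open>Exactness of the kernels carries the correct marginal from each time to the
    next.\<close>
  have Qn: "distr Q borel (\<lambda>\<omega>. \<omega> n) = \<nu> n" for n
  proof (induction n)
    case (Suc n)
    show ?case
    proof (rule measure_eqI)
      fix X assume "X \<in> sets (distr Q borel (\<lambda>\<omega>. \<omega> (Suc n)))"
      then have X[measurable]: "X \<in> sets borel" by simp
      have m: "(\<lambda>y. emeasure (K n y) X) \<in> borel_measurable borel"
        by (rule measurable_emeasure_kernel[OF Ks X])
      have "emeasure (distr Q borel (\<lambda>\<omega>. \<omega> (Suc n))) X = (\<integral>\<^sup>+ \<omega>. indicator X (\<omega> (Suc n)) \<partial>Q)"
        by (rule emeasure_distr_nn_integral) measurable
      also have "\<dots> = (\<integral>\<^sup>+ \<omega>. \<integral>\<^sup>+ z. indicator X z \<partial>K n (\<omega> n) \<partial>Q)"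
        using QS[rule_format, of "\<lambda>p. indicator X (snd p)" n] by simp
      also have "\<dots> = (\<integral>\<^sup>+ \<omega>. emeasure (K n (\<omega> n)) X \<partial>Q)"
        by (simp add: Kx)
      also have "\<dots> = (\<integral>\<^sup>+ y. emeasure (K n y) X \<partial>\<nu> n)"
        unfolding Suc[symmetric] by (rule nn_integral_distr[symmetric]) (simp_all add: m)
      also have "\<dots> = emeasure (\<nu> (Suc n)) X"
        unfolding \<nu>K[symmetric] by (rule emeasure_bind_prob_algebra[symmetric, OF \<nu>P K X])
      finally show "emeasure (distr Q borel (\<lambda>\<omega>. \<omega> (Suc n))) X = emeasure (\<nu> (Suc n)) X" .
    qed (use prob_borelD[OF \<nu>] in simp)
  qed (rule Q0)
  define a where "a n \<omega> = (norm (\<omega> n - \<omega> (Suc n)))\<^sup>2" for n and \<omega> :: "nat \<Rightarrow> 'a"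
  have a[measurable]: "(\<lambda>\<omega>. a n \<omega>) \<in> borel_measurable Q" for n
    unfolding a_def by measurable
  have a_int: "(\<integral>\<^sup>+ \<omega>. ennreal (a n \<omega>) \<partial>Q) \<le> ennreal ((1 / 8) ^ n)" for n
  proof -
    have m: "(\<lambda>y. \<integral>\<^sup>+ z. ennreal ((norm (y - z))\<^sup>2) \<partial>K n y) \<in> borel_measurable borel"
      by (rule nn_integral_measurable_subprob_algebra2[OF _ Ks]) measurable
    have "(\<integral>\<^sup>+ \<omega>. \<integral>\<^sup>+ z. ennreal ((norm (\<omega> n - z))\<^sup>2) \<partial>K n (\<omega> n) \<partial>Q)
        = (\<integral>\<^sup>+ y. \<integral>\<^sup>+ z. ennreal ((norm (y - z))\<^sup>2) \<partial>K n y \<partial>\<nu> n)"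
      unfolding Qn[symmetric] by (rule nn_integral_distr[symmetric]) (simp_all add: m)
    then show ?thesis
      using QS[rule_format, of "\<lambda>p. ennreal ((norm (fst p - snd p))\<^sup>2)" n] cost[of n] by (simp add: a_def)
  qed
  \<comment> \<open>Dominates the squared distance from coordinate \<open>n\<close> to every later
    coordinate, hence also to the limit.\<close>
  define R where "R n \<omega> = (\<Sum>k. ennreal (2 ^ Suc k) * ennreal (a (n + k) \<omega>))" for n \<omega>
  have [measurable]: "R n \<in> borel_measurable Q" for n
    unfolding R_def by measurable
  \<comment> \<open>The rate 1/8 beats the weights: what remains is a geometric series of ratio 1/4,
    with sum 8/3 times \<open>(1 / 8) ^ n\<close>.\<close>
  have R_int: "(\<integral>\<^sup>+ \<omega>. R n \<omega> \<partial>Q) \<le> ennreal (4 * (1 / 8) ^ n)" for n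
  proof -
    have "(\<integral>\<^sup>+ \<omega>. R n \<omega> \<partial>Q) = (\<Sum>k. \<integral>\<^sup>+ \<omega>. ennreal (2 ^ Suc k) * ennreal (a (n + k) \<omega>) \<partial>Q)"
      unfolding R_def by (rule nn_integral_suminf) measurable
    also have "\<dots> = (\<Sum>k. ennreal (2 ^ Suc k) * (\<integral>\<^sup>+ \<omega>. ennreal (a (n + k) \<omega>) \<partial>Q))"
      by (intro suminf_cong nn_integral_cmult) measurable
    also have "\<dots> \<le> (\<Sum>k. ennreal (2 ^ Suc k) * ennreal ((1 / 8) ^ (n + k)))"
      by (intro suminf_le mult_left_mono a_int) auto
    also have "\<dots> = (\<Sum>k. ennreal (2 * (1 / 8) ^ n * (1 / 4) ^ k))"
    proof (rule suminf_cong)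
      fix k
      have "(2 :: real) ^ k * (1 / 8) ^ k = (1 / 4) ^ k"
        by (simp flip: power_mult_distrib)
      then have "(2 :: real) ^ Suc k * (1 / 8) ^ (n + k) = 2 * (1 / 8) ^ n * (1 / 4) ^ k"
        by (metis (no_types, lifting) ab_semigroup_mult_class.mult_ac(1) mult.left_commute power_Suc power_add)
      then show "ennreal (2 ^ Suc k) * ennreal ((1 / 8) ^ (n + k)) = ennreal (2 * (1 / 8) ^ n * (1 / 4) ^ k)"
        by (simp flip: ennreal_mult)
    qed
    also have "\<dots> = ennreal (\<Sum>k. 2 * (1 / 8) ^ n * (1 / 4) ^ k)"
      by (intro suminf_ennreal2 summable_mult summable_geometric) auto
    also have "(\<Sum>k. 2 * (1 / 8) ^ n * (1 / 4 :: real) ^ k) = 2 * (1 / 8) ^ n * (4 / 3)"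
      by (subst suminf_mult) (auto simp: suminf_geometric intro!: summable_geometric)
    also have "ennreal (2 * (1 / 8) ^ n * (4 / 3)) \<le> ennreal (4 * (1 / 8) ^ n)"
      by (intro ennreal_leI) auto
    finally show ?thesis .
  qed
  \<comment> \<open>On divergent paths \<open>lim\<close> is a default value; these paths turn out
    to form a null set.\<close>
  define L where "L \<omega> = lim \<omega>" for \<omega> :: "nat \<Rightarrow> 'a"
  have [measurable]: "L \<in> borel_measurable Q"
    unfolding L_def by (rule borel_measurable_lim_metric) measurable
  have partial: "ennreal (\<Sum>k<m. 2 ^ Suc k * a (n + k) \<omega>) \<le> R n \<omega>" for m n \<omega>
  proof -
    have "ennreal (\<Sum>k<m. 2 ^ Suc k * a (n + k) \<omega>) = (\<Sum>k<m. ennreal (2 ^ Suc k) * ennreal (a (n + k) \<omega>))"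
      by (subst sum_ennreal[symmetric]) (auto simp: a_def ennreal_mult)
    also have "\<dots> \<le> R n \<omega>"
      unfolding R_def by (rule sum_le_suminf) auto
    finally show ?thesis .
  qed
  \<comment> \<open>Finiteness of \<open>R 0\<close> alone makes a path Cauchy, so this single event
    serves every \<open>n\<close>.\<close>
  have "AE \<omega> in Q. R 0 \<omega> \<noteq> \<infinity>"
    using R_int[of 0] by (intro nn_integral_PInf_AE) (auto simp: top_unique)
  then have dist_L: "AE \<omega> in Q. ennreal ((norm (\<omega> n - L \<omega>))\<^sup>2) \<le> R n \<omega>" for n
  proof eventually_elim
    fix \<omega> assume "R 0 \<omega> \<noteq> \<infinity>"
    then obtain B where B: "R 0 \<omega> = ennreal B" "0 \<le> B"
      by (cases "R 0 \<omega>") auto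
    have "(\<Sum>k<m. 2 ^ Suc k * (norm (\<omega> k - \<omega> (Suc k)))\<^sup>2) \<le> B" for m
      using partial[of 0 \<omega> m] B by (simp add: a_def)
    then have "Cauchy \<omega>" by (rule Cauchy_of_weighted_sums_bounded)
    then have "\<omega> \<longlonglongrightarrow> L \<omega>"
      unfolding L_def by (simp add: Cauchy_convergent_iff convergent_LIMSEQ_iff)
    then have "(\<lambda>m. \<omega> (n + m)) \<longlonglongrightarrow> L \<omega>"
      by (subst add.commute) (rule LIMSEQ_ignore_initial_segment)
    then have lim: "(\<lambda>m. ennreal ((norm (\<omega> n - \<omega> (n + m)))\<^sup>2)) \<longlonglongrightarrow> ennreal ((norm (\<omega> n - L \<omega>))\<^sup>2)"
      by (intro tendsto_intros)
    have "ennreal ((norm (\<omega> n - \<omega> (n + m)))\<^sup>2) \<le> R n \<omega>" for m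
      using ennreal_leI[OF norm_diff_sq_le_weighted_sum[of \<omega> n m]] partial[of n \<omega> m]
      unfolding a_def by (rule order_trans)
    then show "ennreal ((norm (\<omega> n - L \<omega>))\<^sup>2) \<le> R n \<omega>"
      by (intro LIMSEQ_le_const2[OF lim]) auto
  qed
  have W: "W2sq (\<nu> n) (distr Q borel L) \<le> ennreal (4 * (1 / 8) ^ n)" for n
  proof -
    have "W2sq (distr Q borel (\<lambda>\<omega>. \<omega> n)) (distr Q borel L) \<le> (\<integral>\<^sup>+ \<omega>. ennreal ((norm (\<omega> n - L \<omega>))\<^sup>2) \<partial>Q)"
      by (rule W2sq_le_distr[OF Q]) measurable
    also have "\<dots> \<le> (\<integral>\<^sup>+ \<omega>. R n \<omega> \<partial>Q)"
      by (rule nn_integral_mono_AE[OF dist_L])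
    also note R_int
    finally show ?thesis unfolding Qn .
  qed
  have "(\<lambda>n. ennreal (4 * (1 / 8) ^ n)) \<longlonglongrightarrow> ennreal (4 * 0)"
    by (intro tendsto_intros LIMSEQ_realpow_zero) auto
  then have lim0: "(\<lambda>n. ennreal (4 * (1 / 8) ^ n)) \<longlonglongrightarrow> 0" by simp
  have "(\<lambda>n. W2sq (\<nu> n) (distr Q borel L)) \<longlonglongrightarrow> 0"
    by (rule tendsto_sandwich[OF _ _ tendsto_const lim0]) (simp_all add: W)
  moreover have "prob_borel (distr Q borel L)"
    by (rule prob_borel_distr[OF Q]) measurable
  ultimately show thesis by (intro that)
qed

section \<open>Squared distances within a finite-distance class\<close>

text \<open>Junk value: this is \<open>0\<close> when the squared distance is infinite, so it is only used inside
  a fixed \<^const>\<open>P2\<close>.\<close>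

definition D2 :: "'a::euclidean_space measure \<Rightarrow> 'a measure \<Rightarrow> real" where
  "D2 \<mu> \<nu> = enn2real (W2sq \<mu> \<nu>)"

lemma D2_nonneg: "0 \<le> D2 \<mu> \<nu>"
  by (simp add: D2_def)

lemma D2_commute: "D2 \<mu> \<nu> = D2 \<nu> \<mu>"
  by (simp add: D2_def W2sq_commute)

lemma D2_le: "W2sq \<mu> \<nu> \<le> ennreal x \<Longrightarrow> 0 \<le> x \<Longrightarrow> D2 \<mu> \<nu> \<le> x"
  unfolding D2_def by (rule enn2real_leI)

lemma P2_prob_borel: "\<mu> \<in> P2 \<omega> \<Longrightarrow> prob_borel \<mu>"
  by (simp add: P2_def)

lemma W2sq_finite_trans:
  assumes "prob_borel a" "prob_borel b" "prob_borel c" "W2sq a b < \<top>" "W2sq b c < \<top>"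
  shows "W2sq a c < \<top>"
  using W2sq_triangle[OF assms(1-3), of 1] assms(4,5)
  by (auto simp: ennreal_mult_less_top intro: le_less_trans)

lemma W2sq_P2_finite:
  assumes "prob_borel \<omega>" "\<mu> \<in> P2 \<omega>" "\<nu> \<in> P2 \<omega>"
  shows "W2sq \<mu> \<nu> < \<top>"
  using assms W2sq_finite_trans[of \<mu> \<omega> \<nu>] by (auto simp: P2_def W2_less_top_iff W2sq_commute)

lemma P2_memI:
  assumes "prob_borel \<omega>" "\<mu> \<in> P2 \<omega>" "prob_borel \<nu>" "W2sq \<mu> \<nu> < \<top>"
  shows "\<nu> \<in> P2 \<omega>"
  using assms W2sq_finite_trans[of \<nu> \<mu> \<omega>] by (auto simp: P2_def W2_less_top_iff W2sq_commute)

lemma W2sq_eq_D2: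
  assumes "prob_borel \<omega>" "\<mu> \<in> P2 \<omega>" "\<nu> \<in> P2 \<omega>"
  shows "W2sq \<mu> \<nu> = ennreal (D2 \<mu> \<nu>)"
  using W2sq_P2_finite[OF assms] by (simp add: D2_def)

lemma D2_triangle:
  assumes \<omega>: "prob_borel \<omega>" and abc: "a \<in> P2 \<omega>" "b \<in> P2 \<omega>" "c \<in> P2 \<omega>" and s: "s > 0"
  shows "D2 a c \<le> (1 + s) * D2 a b + (1 + 1 / s) * D2 b c"
proof (rule D2_le)
  show "W2sq a c \<le> ennreal ((1 + s) * D2 a b + (1 + 1 / s) * D2 b c)"
    using W2sq_triangle[of a b c s] abc[THEN P2_prob_borel] s
    by (simp add: W2sq_eq_D2[OF \<omega>] abc D2_nonneg ennreal_mult)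
  show "0 \<le> (1 + s) * D2 a b + (1 + 1 / s) * D2 b c"
    using s by (simp add: D2_nonneg)
qed

lemma W2_eq_sqrt_D2:
  assumes "prob_borel \<omega>" "\<mu> \<in> P2 \<omega>" "\<nu> \<in> P2 \<omega>"
  shows "W2 \<mu> \<nu> = ennreal (sqrt (D2 \<mu> \<nu>))"
  using W2sq_P2_finite[OF assms] by (simp add: W2_def D2_def)

lemma JKO_obj_eq:
  assumes "prob_borel \<omega>" "\<mu> \<in> P2 \<omega>" "\<nu> \<in> P2 \<omega>"
  shows "JKO_obj E \<tau> \<mu> \<nu> = ereal (D2 \<mu> \<nu> / (2 * \<tau>)) + E \<nu>"
  using W2sq_eq_D2[OF assms] by (simp add: JKO_obj_def W2_power2 enn2ereal_ennreal D2_nonneg)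

text \<open>The exact Hilbert space identity for the squared distance to a point of a segment.
  Integrated against a plan, it is the source of the strong convexity of the squared
  distance.\<close>

lemma norm_diff_convex_comb_sq:
  fixes x y z :: "'a::real_inner"
  shows "(norm (x - ((1 - \<alpha>) *\<^sub>R y + \<alpha> *\<^sub>R z)))\<^sup>2 + \<alpha> * (1 - \<alpha>) * (norm (y - z))\<^sup>2
    = (1 - \<alpha>) * (norm (x - y))\<^sup>2 + \<alpha> * (norm (x - z))\<^sup>2"
  by (simp add: power2_norm_eq_inner inner_diff_left inner_diff_right inner_add_left inner_add_right
      inner_commute algebra_simps)

section \<open>Interpolation along transport plans\<close>

lemma transport_plans_baseD:
  fixes \<Omega> :: "('a::euclidean_space \<times> 'a \<times> 'a) measure"
  assumes "\<Omega> \<in> transport_plans_base \<omega> \<mu>0 \<mu>1"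
  shows "prob_space \<Omega>" and "sets \<Omega> = sets borel"
    and "distr \<Omega> borel fst = \<omega>"
    and "distr \<Omega> borel (\<lambda>p. fst (snd p)) = \<mu>0"
    and "distr \<Omega> borel (\<lambda>p. snd (snd p)) = \<mu>1"
    and "(\<integral>\<^sup>+ p. ennreal ((norm (fst p - fst (snd p)))\<^sup>2) \<partial>\<Omega>) = W2sq \<omega> \<mu>0"
    and "(\<integral>\<^sup>+ p. ennreal ((norm (fst p - snd (snd p)))\<^sup>2) \<partial>\<Omega>) = W2sq \<omega> \<mu>1"
proof -
  have eq: "(\<lambda>(x1, x2, x3). (x1, x2)) = (\<lambda>p :: 'a \<times> 'a \<times> 'a. (fst p, fst (snd p)))"
    "(\<lambda>(x1, x2, x3). (x1, x3)) = (\<lambda>p :: 'a \<times> 'a \<times> 'a. (fst p, snd (snd p)))"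
    by auto
  show \<Omega>: "prob_space \<Omega>" and s[measurable_cong]: "sets \<Omega> = sets borel"
    using assms by (auto simp: transport_plans_base_def)
  have o: "distr \<Omega> borel (\<lambda>p. (fst p, fst (snd p))) \<in> opt_couplings \<omega> \<mu>0"
    "distr \<Omega> borel (\<lambda>p. (fst p, snd (snd p))) \<in> opt_couplings \<omega> \<mu>1"
    using assms by (auto simp: transport_plans_base_def eq)
  show "distr \<Omega> borel fst = \<omega>" "distr \<Omega> borel (\<lambda>p. fst (snd p)) = \<mu>0"
    "distr \<Omega> borel (\<lambda>p. snd (snd p)) = \<mu>1"
    "(\<integral>\<^sup>+ p. ennreal ((norm (fst p - fst (snd p)))\<^sup>2) \<partial>\<Omega>) = W2sq \<omega> \<mu>0"
    "(\<integral>\<^sup>+ p. ennreal ((norm (fst p - snd (snd p)))\<^sup>2) \<partial>\<Omega>) = W2sq \<omega> \<mu>1"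
    using o by (simp_all add: opt_couplings_def couplings_def distr_distr comp_def transport_cost_def
        nn_integral_distr)
qed

text \<open>Here the base of the plan is \<mu>, while \<omega> only fixes the finite-distance class.
  Optimality of the plan against the base turns the integrated identity into convexity of
  \<open>D2 \<mu>\<close> with modulus given by the plan cost \<open>w\<close>. This cost is finite
  by the triangle inequality through the base, and it bounds \<open>D2 \<nu>0 \<nu>1\<close> because
  the plan couples these two measures.\<close>

lemma transport_plan_interpolation:
  fixes \<Omega> :: "('a::euclidean_space \<times> 'a \<times> 'a) measure"
  assumes \<omega>: "prob_borel \<omega>" and P: "\<mu> \<in> P2 \<omega>" "\<nu>0 \<in> P2 \<omega>" "\<nu>1 \<in> P2 \<omega>"
    and plan: "\<Omega> \<in> transport_plans_base \<mu> \<nu>0 \<nu>1"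
  obtains w where "W2_plan_sq \<Omega> = ennreal w" and "0 \<le> w" and "D2 \<nu>0 \<nu>1 \<le> w"
    and "\<And>\<alpha>. \<alpha> \<in> {0..1} \<Longrightarrow> gen_geodesic \<Omega> \<alpha> \<in> P2 \<omega>"
    and "\<And>\<alpha>. \<alpha> \<in> {0..1} \<Longrightarrow>
      D2 \<mu> (gen_geodesic \<Omega> \<alpha>) \<le> (1 - \<alpha>) * D2 \<mu> \<nu>0 + \<alpha> * D2 \<mu> \<nu>1 - \<alpha> * (1 - \<alpha>) * w"
proof -
  note d = transport_plans_baseD[OF plan]
  note [measurable_cong] = d(2)
  note fin = W2sq_eq_D2[OF \<omega> P(1)]
  have "W2_plan_sq \<Omega> \<le> (\<integral>\<^sup>+ p. 2 * ennreal ((norm (fst p - fst (snd p)))\<^sup>2)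
      + 2 * ennreal ((norm (fst p - snd (snd p)))\<^sup>2) \<partial>\<Omega>)"
    unfolding W2_plan_sq_def
  proof (rule nn_integral_mono)
    fix p :: "'a \<times> 'a \<times> 'a"
    have "(norm (fst (snd p) - snd (snd p)))\<^sup>2
        \<le> 2 * (norm (fst p - fst (snd p)))\<^sup>2 + 2 * (norm (fst p - snd (snd p)))\<^sup>2"
      using norm_diff_sq_le[of 1 "fst (snd p)" "snd (snd p)" "fst p"] by (simp add: norm_minus_commute)
    then have "ennreal ((norm (fst (snd p) - snd (snd p)))\<^sup>2)
        \<le> ennreal (2 * (norm (fst p - fst (snd p)))\<^sup>2 + 2 * (norm (fst p - snd (snd p)))\<^sup>2)"
      by (rule ennreal_leI)
    then show "ennreal ((norm (fst (snd p) - snd (snd p)))\<^sup>2)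
        \<le> 2 * ennreal ((norm (fst p - fst (snd p)))\<^sup>2) + 2 * ennreal ((norm (fst p - snd (snd p)))\<^sup>2)"
      by (simp add: ennreal_mult)
  qed
  also have "\<dots> = 2 * W2sq \<mu> \<nu>0 + 2 * W2sq \<mu> \<nu>1"
    by (simp add: nn_integral_add nn_integral_cmult d(6,7))
  also have "\<dots> < \<top>"
    by (simp add: fin P ennreal_mult_less_top)
  finally obtain w where w: "W2_plan_sq \<Omega> = ennreal w" "0 \<le> w"
    by (cases "W2_plan_sq \<Omega>") auto
  have D: "W2sq \<mu> (gen_geodesic \<Omega> \<alpha>) \<le> ennreal ((1 - \<alpha>) * D2 \<mu> \<nu>0 + \<alpha> * D2 \<mu> \<nu>1 - \<alpha> * (1 - \<alpha>) * w)"
    and g: "prob_borel (gen_geodesic \<Omega> \<alpha>)"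
    and nonneg: "0 \<le> (1 - \<alpha>) * D2 \<mu> \<nu>0 + \<alpha> * D2 \<mu> \<nu>1 - \<alpha> * (1 - \<alpha>) * w"
    if \<alpha>: "\<alpha> \<in> {0..1}" for \<alpha>
  proof -
    let ?Y = "\<lambda>p. (1 - \<alpha>) *\<^sub>R fst (snd p) + \<alpha> *\<^sub>R snd (snd p) :: 'a"
    let ?I = "\<integral>\<^sup>+ p. ennreal ((norm (fst p - ?Y p))\<^sup>2) \<partial>\<Omega>"
    have eq: "gen_geodesic \<Omega> \<alpha> = distr \<Omega> borel ?Y"
      unfolding gen_geodesic_def by (rule arg_cong[where f="distr \<Omega> borel"]) auto
    show "prob_borel (gen_geodesic \<Omega> \<alpha>)"
      unfolding eq by (rule prob_borel_distr[OF d(1)]) measurable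
    have "W2sq (distr \<Omega> borel fst) (distr \<Omega> borel ?Y) \<le> ?I"
      by (rule W2sq_le_distr[OF d(1)]) measurable
    then have le: "W2sq \<mu> (gen_geodesic \<Omega> \<alpha>) \<le> ?I"
      by (simp add: d(3) eq)
    \<comment> \<open>The plan cost is added on the left, and subtracted only once \<open>?I\<close>
      is known to be a real number.\<close>
    have "?I + ennreal (\<alpha> * (1 - \<alpha>) * w)
        = (\<integral>\<^sup>+ p. ennreal ((norm (fst p - ?Y p))\<^sup>2)
            + ennreal (\<alpha> * (1 - \<alpha>)) * ennreal ((norm (fst (snd p) - snd (snd p)))\<^sup>2) \<partial>\<Omega>)"
      using \<alpha> w by (simp add: nn_integral_add nn_integral_cmult W2_plan_sq_def ennreal_mult)
    also have "\<dots> = (\<integral>\<^sup>+ p. ennreal (1 - \<alpha>) * ennreal ((norm (fst p - fst (snd p)))\<^sup>2)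
            + ennreal \<alpha> * ennreal ((norm (fst p - snd (snd p)))\<^sup>2) \<partial>\<Omega>)"
      using \<alpha> by (intro nn_integral_cong)
        (simp add: norm_diff_convex_comb_sq flip: ennreal_mult ennreal_plus)
    also have "\<dots> = ennreal (1 - \<alpha>) * W2sq \<mu> \<nu>0 + ennreal \<alpha> * W2sq \<mu> \<nu>1"
      by (simp add: nn_integral_add nn_integral_cmult d(6,7))
    also have "\<dots> = ennreal ((1 - \<alpha>) * D2 \<mu> \<nu>0 + \<alpha> * D2 \<mu> \<nu>1)"
      using \<alpha> by (simp add: fin P D2_nonneg ennreal_mult)
    finally have sum: "?I + ennreal (\<alpha> * (1 - \<alpha>) * w) = ennreal ((1 - \<alpha>) * D2 \<mu> \<nu>0 + \<alpha> * D2 \<mu> \<nu>1)" .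
    then obtain i where i: "?I = ennreal i" "0 \<le> i"
      by (cases ?I) auto
    have "0 \<le> \<alpha> * (1 - \<alpha>) * w" "0 \<le> (1 - \<alpha>) * D2 \<mu> \<nu>0 + \<alpha> * D2 \<mu> \<nu>1"
      using \<alpha> w by (simp_all add: D2_nonneg)
    then have "i + \<alpha> * (1 - \<alpha>) * w = (1 - \<alpha>) * D2 \<mu> \<nu>0 + \<alpha> * D2 \<mu> \<nu>1"
      using sum i by (simp flip: ennreal_plus)
    then have "i = (1 - \<alpha>) * D2 \<mu> \<nu>0 + \<alpha> * D2 \<mu> \<nu>1 - \<alpha> * (1 - \<alpha>) * w" by simp
    then show "W2sq \<mu> (gen_geodesic \<Omega> \<alpha>) \<le> ennreal ((1 - \<alpha>) * D2 \<mu> \<nu>0 + \<alpha> * D2 \<mu> \<nu>1 - \<alpha> * (1 - \<alpha>) * w)"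
      and "0 \<le> (1 - \<alpha>) * D2 \<mu> \<nu>0 + \<alpha> * D2 \<mu> \<nu>1 - \<alpha> * (1 - \<alpha>) * w"
      using le i by simp_all
  qed
  show thesis
  proof
    show "W2_plan_sq \<Omega> = ennreal w" "0 \<le> w" by fact+
    have "W2sq (distr \<Omega> borel (\<lambda>p. fst (snd p))) (distr \<Omega> borel (\<lambda>p. snd (snd p))) \<le> W2_plan_sq \<Omega>"
      unfolding W2_plan_sq_def by (rule W2sq_le_distr[OF d(1)]) measurable
    then show "D2 \<nu>0 \<nu>1 \<le> w"
      unfolding d(4,5) w(1) using w(2) by (rule D2_le)
    show "gen_geodesic \<Omega> \<alpha> \<in> P2 \<omega>" if "\<alpha> \<in> {0..1}" for \<alpha>
      using D[OF that] by (intro P2_memI[OF \<omega> P(1) g[OF that]]) (auto intro: le_less_trans)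
    show "D2 \<mu> (gen_geodesic \<Omega> \<alpha>) \<le> (1 - \<alpha>) * D2 \<mu> \<nu>0 + \<alpha> * D2 \<mu> \<nu>1 - \<alpha> * (1 - \<alpha>) * w"
      if "\<alpha> \<in> {0..1}" for \<alpha>
      by (rule D2_le[OF D[OF that] nonneg[OF that]])
  qed
qed

section \<open>The proximal functional\<close>

text \<open>Coercivity and lower semicontinuity are assumed separately where existence is proved:
  the former bounds the functional below, the latter handles the limit of a minimizing
  sequence.\<close>

locale convex_energy =
  fixes \<omega>0 :: "'a::euclidean_space measure" and E :: "'a measure \<Rightarrow> ereal" and lam :: real
  assumes \<omega>0: "prob_borel \<omega>0"
    and E_values: "\<forall>\<nu>\<in>P2 \<omega>0. E \<nu> \<noteq> -\<infinity>"
    and proper: "proper_energy \<omega>0 E"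
    and convex: "convex_gen_geod \<omega>0 E lam"
begin

definition edom :: "'a measure set" where
  "edom = {\<nu> \<in> P2 \<omega>0. E \<nu> < \<infinity>}"

text \<open>\<open>real_of_ereal\<close> sends \<infinity> to 0, so \<open>E\<^sub>r\<close> and
  \<open>phi\<close> are meaningful only on \<open>edom\<close>.\<close>

definition E\<^sub>r :: "'a measure \<Rightarrow> real" where
  "E\<^sub>r \<nu> = real_of_ereal (E \<nu>)"

definition phi :: "real \<Rightarrow> 'a measure \<Rightarrow> 'a measure \<Rightarrow> real" where
  "phi \<tau> \<mu> \<nu> = D2 \<mu> \<nu> / (2 * \<tau>) + E\<^sub>r \<nu>"

text \<open>Exactly the predicate under \<open>THE\<close> in \<open>resolvent\<close>.\<close>

definition minimizer :: "real \<Rightarrow> 'a measure \<Rightarrow> 'a measure \<Rightarrow> bool" where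
  "minimizer \<tau> \<mu> \<nu> \<longleftrightarrow> \<nu> \<in> P2 \<omega>0 \<and> (\<forall>\<nu>'\<in>P2 \<omega>0. JKO_obj E \<tau> \<mu> \<nu> \<le> JKO_obj E \<tau> \<mu> \<nu>')"

section \<open>Reduction to a real-valued functional on the domain\<close>

lemma dom_P2: "\<nu> \<in> edom \<Longrightarrow> \<nu> \<in> P2 \<omega>0"
  by (simp add: edom_def)

lemma E_eq: "\<nu> \<in> edom \<Longrightarrow> E \<nu> = ereal (E\<^sub>r \<nu>)"
  using E_values by (cases "E \<nu>") (auto simp: edom_def E\<^sub>r_def)

lemma dom_nonempty: "\<exists>\<nu>. \<nu> \<in> edom"
  using proper by (auto simp: proper_energy_def edom_def)

lemma JKO_obj_dom: "\<mu> \<in> P2 \<omega>0 \<Longrightarrow> \<nu> \<in> edom \<Longrightarrow> JKO_obj E \<tau> \<mu> \<nu> = ereal (phi \<tau> \<mu> \<nu>)"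
  by (simp add: JKO_obj_eq[OF \<omega>0] dom_P2 E_eq phi_def)

lemma JKO_obj_notin_dom: "\<mu> \<in> P2 \<omega>0 \<Longrightarrow> \<nu> \<in> P2 \<omega>0 \<Longrightarrow> \<nu> \<notin> edom \<Longrightarrow> JKO_obj E \<tau> \<mu> \<nu> = \<infinity>"
  by (simp add: JKO_obj_eq[OF \<omega>0] edom_def)

text \<open>By properness some competitor has a finite value, so a minimizer has finite energy, and
  competitors outside the domain have the value \<infinity>.\<close>

lemma minimizer_iff:
  assumes "\<mu> \<in> P2 \<omega>0"
  shows "minimizer \<tau> \<mu> \<nu> \<longleftrightarrow> \<nu> \<in> edom \<and> (\<forall>\<nu>'\<in>edom. phi \<tau> \<mu> \<nu> \<le> phi \<tau> \<mu> \<nu>')"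
proof
  assume m: "minimizer \<tau> \<mu> \<nu>"
  obtain \<nu>' where \<nu>': "\<nu>' \<in> edom" using dom_nonempty by blast
  have "JKO_obj E \<tau> \<mu> \<nu> \<le> ereal (phi \<tau> \<mu> \<nu>')"
    using m \<nu>' by (simp add: minimizer_def dom_P2 flip: JKO_obj_dom[OF assms])
  then have \<nu>: "\<nu> \<in> edom"
    using m JKO_obj_notin_dom[OF assms, of \<nu> \<tau>] by (cases "\<nu> \<in> edom") (auto simp: minimizer_def)
  moreover have "phi \<tau> \<mu> \<nu> \<le> phi \<tau> \<mu> \<nu>'" if "\<nu>' \<in> edom" for \<nu>'
    using m \<nu> that by (auto simp: minimizer_def JKO_obj_dom[OF assms] dom_P2 dest!: bspec[of _ _ \<nu>'])
  ultimately show "\<nu> \<in> edom \<and> (\<forall>\<nu>'\<in>edom. phi \<tau> \<mu> \<nu> \<le> phi \<tau> \<mu> \<nu>')" by blast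
next
  assume m: "\<nu> \<in> edom \<and> (\<forall>\<nu>'\<in>edom. phi \<tau> \<mu> \<nu> \<le> phi \<tau> \<mu> \<nu>')"
  show "minimizer \<tau> \<mu> \<nu>"
    unfolding minimizer_def
  proof (intro conjI ballI)
    show "\<nu> \<in> P2 \<omega>0" using m dom_P2 by blast
    fix \<nu>' assume "\<nu>' \<in> P2 \<omega>0"
    then show "JKO_obj E \<tau> \<mu> \<nu> \<le> JKO_obj E \<tau> \<mu> \<nu>'"
      using m by (cases "\<nu>' \<in> edom") (auto simp: JKO_obj_dom JKO_obj_notin_dom assms)
  qed
qed

text \<open>The plan supplied by convexity of \<open>E\<close> serves both terms of the functional,
  with the same cost \<open>w\<close> in both estimates. Their moduli can therefore be added, even
  when \<open>lam\<close> is negative.\<close>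

lemma interpolation:
  assumes \<mu>: "\<mu> \<in> P2 \<omega>0" and \<nu>: "\<nu>0 \<in> edom" "\<nu>1 \<in> edom"
  obtains \<Omega> w where "\<Omega> \<in> transport_plans_base \<mu> \<nu>0 \<nu>1" and "W2_plan_sq \<Omega> = ennreal w"
    and "0 \<le> w" and "D2 \<nu>0 \<nu>1 \<le> w"
    and "\<And>\<alpha>. \<alpha> \<in> {0..1} \<Longrightarrow> gen_geodesic \<Omega> \<alpha> \<in> edom"
    and "\<And>\<alpha>. \<alpha> \<in> {0..1} \<Longrightarrow>
      D2 \<mu> (gen_geodesic \<Omega> \<alpha>) \<le> (1 - \<alpha>) * D2 \<mu> \<nu>0 + \<alpha> * D2 \<mu> \<nu>1 - \<alpha> * (1 - \<alpha>) * w"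
    and "\<And>\<alpha>. \<alpha> \<in> {0..1} \<Longrightarrow>
      E\<^sub>r (gen_geodesic \<Omega> \<alpha>) \<le> (1 - \<alpha>) * E\<^sub>r \<nu>0 + \<alpha> * E\<^sub>r \<nu>1 - \<alpha> * (1 - \<alpha>) * lam / 2 * w"
proof -
  obtain \<Omega> where plan: "\<Omega> \<in> transport_plans_base \<mu> \<nu>0 \<nu>1"
    and conv: "\<forall>\<alpha>\<in>{0..1}. E (gen_geodesic \<Omega> \<alpha>) \<le> ereal (1 - \<alpha>) * E \<nu>0 + ereal \<alpha> * E \<nu>1
           - ereal (\<alpha> * (1 - \<alpha>) * lam / 2) * enn2ereal (W2_plan_sq \<Omega>)"
    using convex \<mu> \<nu>[THEN dom_P2] unfolding convex_gen_geod_def by blast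
  obtain w where w: "W2_plan_sq \<Omega> = ennreal w" "0 \<le> w" "D2 \<nu>0 \<nu>1 \<le> w"
    and g: "\<And>\<alpha>. \<alpha> \<in> {0..1} \<Longrightarrow> gen_geodesic \<Omega> \<alpha> \<in> P2 \<omega>0"
    and D: "\<And>\<alpha>. \<alpha> \<in> {0..1} \<Longrightarrow>
      D2 \<mu> (gen_geodesic \<Omega> \<alpha>) \<le> (1 - \<alpha>) * D2 \<mu> \<nu>0 + \<alpha> * D2 \<mu> \<nu>1 - \<alpha> * (1 - \<alpha>) * w"
    using transport_plan_interpolation[OF \<omega>0 \<mu> \<nu>[THEN dom_P2] plan] by metis
  have le: "E (gen_geodesic \<Omega> \<alpha>) \<le> ereal ((1 - \<alpha>) * E\<^sub>r \<nu>0 + \<alpha> * E\<^sub>r \<nu>1 - \<alpha> * (1 - \<alpha>) * lam / 2 * w)"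
    if "\<alpha> \<in> {0..1}" for \<alpha>
    using conv that w by (simp add: E_eq \<nu> enn2ereal_ennreal)
  have edom: "gen_geodesic \<Omega> \<alpha> \<in> edom" if "\<alpha> \<in> {0..1}" for \<alpha>
    using le[OF that] g[OF that] by (auto simp: edom_def intro: le_less_trans)
  have "E\<^sub>r (gen_geodesic \<Omega> \<alpha>) \<le> (1 - \<alpha>) * E\<^sub>r \<nu>0 + \<alpha> * E\<^sub>r \<nu>1 - \<alpha> * (1 - \<alpha>) * lam / 2 * w"
    if "\<alpha> \<in> {0..1}" for \<alpha>
    using le[OF that] E_eq[OF edom[OF that]] by simp
  with plan w edom D show thesis by (intro that)
qed

text \<open>At \<alpha> = 1/2 the distance term gains \<open>w / (8 * \<tau>)\<close> and the energy
  gains \<open>lam * w / 8\<close>; the inequality is then doubled.\<close>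

lemma midpoint:
  assumes \<mu>: "\<mu> \<in> P2 \<omega>0" and \<nu>: "\<nu>0 \<in> edom" "\<nu>1 \<in> edom" and \<tau>: "\<tau> > 0"
  obtains \<Omega> w \<nu> where "\<Omega> \<in> transport_plans_base \<mu> \<nu>0 \<nu>1" and "W2_plan_sq \<Omega> = ennreal w"
    and "0 \<le> w" and "D2 \<nu>0 \<nu>1 \<le> w" and "\<nu> \<in> edom"
    and "2 * phi \<tau> \<mu> \<nu> + (1 / \<tau> + lam) / 4 * w \<le> phi \<tau> \<mu> \<nu>0 + phi \<tau> \<mu> \<nu>1"
proof -
  obtain \<Omega> w where 1: "\<Omega> \<in> transport_plans_base \<mu> \<nu>0 \<nu>1" "W2_plan_sq \<Omega> = ennreal w"
    "0 \<le> w" "D2 \<nu>0 \<nu>1 \<le> w"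
    and g: "\<And>\<alpha>. \<alpha> \<in> {0..1} \<Longrightarrow> gen_geodesic \<Omega> \<alpha> \<in> edom"
    and D: "\<And>\<alpha>. \<alpha> \<in> {0..1} \<Longrightarrow>
      D2 \<mu> (gen_geodesic \<Omega> \<alpha>) \<le> (1 - \<alpha>) * D2 \<mu> \<nu>0 + \<alpha> * D2 \<mu> \<nu>1 - \<alpha> * (1 - \<alpha>) * w"
    and e: "\<And>\<alpha>. \<alpha> \<in> {0..1} \<Longrightarrow>
      E\<^sub>r (gen_geodesic \<Omega> \<alpha>) \<le> (1 - \<alpha>) * E\<^sub>r \<nu>0 + \<alpha> * E\<^sub>r \<nu>1 - \<alpha> * (1 - \<alpha>) * lam / 2 * w"
    using interpolation[OF \<mu> \<nu>] by metis
  let ?g = "gen_geodesic \<Omega> (1 / 2)"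
  have "D2 \<mu> ?g / (2 * \<tau>) \<le> (D2 \<mu> \<nu>0 / 2 + D2 \<mu> \<nu>1 / 2 - w / 4) / (2 * \<tau>)"
    using D[of "1 / 2"] \<tau> by (intro divide_right_mono) auto
  also have "\<dots> = (D2 \<mu> \<nu>0 / (2 * \<tau>) + D2 \<mu> \<nu>1 / (2 * \<tau>)) / 2 - 1 / \<tau> / 8 * w"
    using \<tau> by (simp add: field_simps)
  finally have "D2 \<mu> ?g / (2 * \<tau>) \<le> (D2 \<mu> \<nu>0 / (2 * \<tau>) + D2 \<mu> \<nu>1 / (2 * \<tau>)) / 2 - 1 / \<tau> / 8 * w" .
  moreover have "E\<^sub>r ?g \<le> (E\<^sub>r \<nu>0 + E\<^sub>r \<nu>1) / 2 - lam / 8 * w"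
    using e[of "1 / 2"] by (simp add: add_divide_distrib)
  moreover have "(1 / \<tau> + lam) / 8 * w = 1 / \<tau> / 8 * w + lam / 8 * w"
    by (simp only: add_divide_distrib distrib_right)
  moreover have "(phi \<tau> \<mu> \<nu>0 + phi \<tau> \<mu> \<nu>1) / 2
      = (D2 \<mu> \<nu>0 / (2 * \<tau>) + D2 \<mu> \<nu>1 / (2 * \<tau>)) / 2 + (E\<^sub>r \<nu>0 + E\<^sub>r \<nu>1) / 2"
    by (simp only: phi_def add_divide_distrib ac_simps)
  ultimately have "phi \<tau> \<mu> ?g + (1 / \<tau> + lam) / 8 * w \<le> (phi \<tau> \<mu> \<nu>0 + phi \<tau> \<mu> \<nu>1) / 2"
    unfolding phi_def[of \<tau> \<mu> ?g] by argo
  then have "2 * phi \<tau> \<mu> ?g + (1 / \<tau> + lam) / 4 * w \<le> phi \<tau> \<mu> \<nu>0 + phi \<tau> \<mu> \<nu>1"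
    by argo
  with 1 g[of "1 / 2"] show thesis by (intro that[of \<Omega> w ?g]) auto
qed

text \<open>The midpoint cannot lie below two minimal values, so \<open>w = 0\<close>. The plan is
  then concentrated where its last two coordinates agree, and its marginals coincide.\<close>

lemma minimizer_unique:
  assumes \<mu>: "\<mu> \<in> P2 \<omega>0" and \<tau>: "\<tau> > 0" "1 / \<tau> + lam > 0"
    and m: "minimizer \<tau> \<mu> \<nu>0" "minimizer \<tau> \<mu> \<nu>1"
  shows "\<nu>0 = \<nu>1"
proof -
  have \<nu>: "\<nu>0 \<in> edom" "\<nu>1 \<in> edom" using m minimizer_iff[OF \<mu>] by blast+
  obtain \<Omega> w \<nu> where 1: "\<Omega> \<in> transport_plans_base \<mu> \<nu>0 \<nu>1" "W2_plan_sq \<Omega> = ennreal w"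
    "0 \<le> w" "\<nu> \<in> edom"
    and phi: "2 * phi \<tau> \<mu> \<nu> + (1 / \<tau> + lam) / 4 * w \<le> phi \<tau> \<mu> \<nu>0 + phi \<tau> \<mu> \<nu>1"
    using midpoint[OF \<mu> \<nu> \<tau>(1)] by metis
  have "phi \<tau> \<mu> \<nu>0 \<le> phi \<tau> \<mu> \<nu>" "phi \<tau> \<mu> \<nu>1 \<le> phi \<tau> \<mu> \<nu>"
    using m \<open>\<nu> \<in> edom\<close> minimizer_iff[OF \<mu>] by blast+
  moreover define k where "k = (1 / \<tau> + lam) / 4"
  ultimately have "k * w \<le> 0" using phi unfolding k_def[symmetric] by linarith
  moreover have "k > 0" using \<tau>(2) by (simp add: k_def)
  ultimately have "w = 0" using \<open>0 \<le> w\<close> by (simp add: mult_le_0_iff)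
  note d = transport_plans_baseD[OF 1(1)]
  note [measurable_cong] = d(2)
  have "(\<integral>\<^sup>+ p. ennreal ((norm (fst (snd p) - snd (snd p)))\<^sup>2) \<partial>\<Omega>) = 0"
    using 1(2) \<open>w = 0\<close> by (simp add: W2_plan_sq_def)
  then have "AE p in \<Omega>. ennreal ((norm (fst (snd p) - snd (snd p)))\<^sup>2) = 0"
    by (subst (asm) nn_integral_0_iff_AE) measurable
  then have "AE p in \<Omega>. fst (snd p) = snd (snd p)"
    by eventually_elim (simp add: ennreal_eq_0_iff)
  then have "distr \<Omega> borel (\<lambda>p. fst (snd p)) = distr \<Omega> borel (\<lambda>p. snd (snd p))"
    by (intro distr_cong_AE) auto
  then show ?thesis by (simp add: d(4,5))
qed

text \<open>Coercivity gives a bound for one step and one base point only. Applied at a point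
  shortly after the start of a generalized geodesic from a fixed \<open>\<nu>s\<close> to \<nu>, it
  shows that \<open>E\<^sub>r \<nu>\<close> decreases at most like
  \<open>A * D2 \<nu>s \<nu>\<close>. Since \<open>A < 1 / (2 * \<tau>)\<close>, the distance term
  of \<open>phi\<close> absorbs this.\<close>

lemma phi_bounded_below:
  assumes coercive: "coercive_energy \<omega>0 E" and \<mu>: "\<mu> \<in> P2 \<omega>0" and \<tau>: "\<tau> > 0" "1 / \<tau> + lam > 0"
  obtains c where "\<And>\<nu>. \<nu> \<in> edom \<Longrightarrow> c \<le> phi \<tau> \<mu> \<nu>"
proof -
  obtain \<tau>0 u0 where \<tau>0: "\<tau>0 > 0" and u0: "u0 \<in> P2 \<omega>0"
    and "(INF v\<in>P2 \<omega>0. ereal (1 / (2 * \<tau>0)) * enn2ereal ((W2 u0 v)\<^sup>2) + E v) > -\<infinity>"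
    using coercive unfolding coercive_energy_def by blast
  then have "(INF v\<in>P2 \<omega>0. JKO_obj E \<tau>0 u0 v) > -\<infinity>"
    by (simp add: JKO_obj_def)
  then obtain c0 where c0: "ereal c0 < (INF v\<in>P2 \<omega>0. JKO_obj E \<tau>0 u0 v)"
    using ereal_dense2 by blast
  have c0: "c0 \<le> phi \<tau>0 u0 \<nu>" if "\<nu> \<in> edom" for \<nu>
  proof -
    have "ereal c0 \<le> JKO_obj E \<tau>0 u0 \<nu>"
      using c0 dom_P2[OF that] by (meson INF_lower less_imp_le order_trans)
    then show ?thesis using JKO_obj_dom[OF u0 that] by simp
  qed
  obtain \<nu>s where \<nu>s: "\<nu>s \<in> edom" using dom_nonempty by blast
  \<comment> \<open>The negative part of \<open>lam\<close>.\<close>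
  define L where "L = max 0 (- lam)"
  have L: "0 \<le> L" "- lam \<le> L" "L < 1 / \<tau>" using \<tau> by (auto simp: L_def)
  \<comment> \<open>Small enough that \<open>A\<close>, defined below, is at most
    \<open>(1 / \<tau> + L) / 4\<close>, which is less than \<open>1 / (2 * \<tau>)\<close>.\<close>
  define \<alpha> where "\<alpha> = min 1 (\<tau>0 * (1 / \<tau> - L) / 4)"
  have \<alpha>: "0 < \<alpha>" "\<alpha> \<le> 1" "\<alpha> / \<tau>0 \<le> (1 / \<tau> - L) / 4"
  proof -
    have "0 < \<tau>0 * (1 / \<tau> - L) / 4" using L \<tau>0 by simp
    then show "0 < \<alpha>" "\<alpha> \<le> 1" by (auto simp: \<alpha>_def)
    have "\<alpha> \<le> \<tau>0 * (1 / \<tau> - L) / 4" unfolding \<alpha>_def by (rule min.cobounded2)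
    then have "\<alpha> \<le> (1 / \<tau> - L) / 4 * \<tau>0" by (simp only: mult.commute times_divide_eq_left)
    then show "\<alpha> / \<tau>0 \<le> (1 / \<tau> - L) / 4" using \<tau>0 by (simp only: pos_divide_le_eq)
  qed
  define A where "A = \<alpha> / \<tau>0 + L / 2"
  have A: "0 < A" "A < 1 / (2 * \<tau>)"
  proof -
    show "0 < A" using \<alpha> \<tau>0 L by (simp add: A_def add_pos_nonneg)
    have "A \<le> (1 / \<tau> + L) / 4" using \<alpha>(3) by (simp add: A_def)
    also have "\<dots> < 1 / (2 * \<tau>)" using L(3) by simp
    finally show "A < 1 / (2 * \<tau>)" .
  qed
  \<comment> \<open>Spends the whole gap between \<open>A\<close> and
    \<open>1 / (2 * \<tau>)\<close> on moving the distance from \<open>\<nu>s\<close> to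
    \<mu>.\<close>
  define s where "s = 1 / (2 * \<tau> * A) - 1"
  have s: "s > 0" "(1 + s) * A = 1 / (2 * \<tau>)"
    using A \<tau> by (auto simp: s_def field_simps)
  define c1 where "c1 = (c0 - D2 u0 \<nu>s / \<tau>0 - (1 - \<alpha>) * E\<^sub>r \<nu>s) / \<alpha>"
  show thesis
  proof
    fix \<nu> assume \<nu>: "\<nu> \<in> edom"
    \<comment> \<open>The base of the plan is its own starting measure \<open>\<nu>s\<close>, so the
      term \<open>D2 \<nu>s \<nu>s\<close> vanishes.\<close>
    obtain \<Omega> w where w: "0 \<le> w" "D2 \<nu>s \<nu> \<le> w"
      and g: "\<And>\<alpha>. \<alpha> \<in> {0..1} \<Longrightarrow> gen_geodesic \<Omega> \<alpha> \<in> edom"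
      and D: "\<And>\<alpha>. \<alpha> \<in> {0..1} \<Longrightarrow>
        D2 \<nu>s (gen_geodesic \<Omega> \<alpha>) \<le> (1 - \<alpha>) * D2 \<nu>s \<nu>s + \<alpha> * D2 \<nu>s \<nu> - \<alpha> * (1 - \<alpha>) * w"
      and e: "\<And>\<alpha>. \<alpha> \<in> {0..1} \<Longrightarrow>
        E\<^sub>r (gen_geodesic \<Omega> \<alpha>) \<le> (1 - \<alpha>) * E\<^sub>r \<nu>s + \<alpha> * E\<^sub>r \<nu> - \<alpha> * (1 - \<alpha>) * lam / 2 * w"
      using interpolation[OF dom_P2[OF \<nu>s] \<nu>s \<nu>] by metis
    let ?S = "D2 \<nu>s \<nu>" and ?g = "gen_geodesic \<Omega> \<alpha>"
    have \<alpha>01: "\<alpha> \<in> {0..1}" using \<alpha> by simp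
    have "D2 \<nu>s \<nu>s = 0"
      using W2sq_refl[OF P2_prob_borel[OF dom_P2[OF \<nu>s]]] by (simp add: D2_def)
    then have Dg: "D2 \<nu>s ?g \<le> \<alpha> * ?S - \<alpha> * ((1 - \<alpha>) * w)"
      using D[OF \<alpha>01] by (simp add: mult.assoc)
    have "\<alpha> * ((1 - \<alpha>) * ?S) \<le> \<alpha> * ((1 - \<alpha>) * w)"
      using \<alpha> w by (intro mult_left_mono) auto
    then have Dg2: "D2 \<nu>s ?g \<le> \<alpha> * (\<alpha> * ?S)"
      using Dg by (simp add: algebra_simps)
    \<comment> \<open>Nonnegativity of the distance bounds the plan cost from above, as is required
      when \<open>lam\<close> is negative.\<close>
    have "\<alpha> * ((1 - \<alpha>) * w) \<le> \<alpha> * ?S"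
      using Dg D2_nonneg[of \<nu>s ?g] by linarith
    then have wS: "(1 - \<alpha>) * w \<le> ?S" using \<alpha>(1) by simp
    have "- lam * ((1 - \<alpha>) * w) \<le> L * ((1 - \<alpha>) * w)"
      using L(2) \<alpha> w by (intro mult_right_mono) auto
    also have "\<dots> \<le> L * ?S" using wS L(1) by (rule mult_left_mono)
    finally have lamw: "\<alpha> * (- lam * ((1 - \<alpha>) * w)) \<le> \<alpha> * (L * ?S)"
      using \<alpha>(1) by (intro mult_left_mono) auto
    have "D2 u0 ?g \<le> 2 * D2 u0 \<nu>s + 2 * D2 \<nu>s ?g"
      using D2_triangle[OF \<omega>0 u0 dom_P2[OF \<nu>s] dom_P2[OF g[OF \<alpha>01]], of 1] by simp
    also have "\<dots> \<le> 2 * D2 u0 \<nu>s + 2 * (\<alpha> * (\<alpha> * ?S))"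
      using Dg2 by simp
    finally have "D2 u0 ?g / (2 * \<tau>0) \<le> (2 * D2 u0 \<nu>s + 2 * (\<alpha> * (\<alpha> * ?S))) / (2 * \<tau>0)"
      using \<tau>0 by (intro divide_right_mono) auto
    also have "\<dots> = D2 u0 \<nu>s / \<tau>0 + \<alpha> * (\<alpha> / \<tau>0 * ?S)"
      using \<tau>0 by (simp add: field_simps)
    finally have "c0 \<le> D2 u0 \<nu>s / \<tau>0 + \<alpha> * (\<alpha> / \<tau>0 * ?S) + E\<^sub>r ?g"
      using c0[OF g[OF \<alpha>01]] unfolding phi_def by linarith
    moreover have "E\<^sub>r ?g \<le> (1 - \<alpha>) * E\<^sub>r \<nu>s + \<alpha> * E\<^sub>r \<nu> + \<alpha> * (L * ?S) / 2"
    proof -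
      have "\<alpha> * (1 - \<alpha>) * lam / 2 * w = - (\<alpha> * (- lam * ((1 - \<alpha>) * w)) / 2)"
        by (simp add: mult_ac)
      moreover have "\<alpha> * (- lam * ((1 - \<alpha>) * w)) / 2 \<le> \<alpha> * (L * ?S) / 2"
        using lamw by (rule divide_right_mono) simp
      ultimately show ?thesis using e[OF \<alpha>01] by linarith
    qed
    ultimately have "c0 - D2 u0 \<nu>s / \<tau>0 - (1 - \<alpha>) * E\<^sub>r \<nu>s \<le> \<alpha> * (E\<^sub>r \<nu> + A * ?S)"
      by (simp add: A_def algebra_simps)
    then have "c1 \<le> E\<^sub>r \<nu> + A * ?S"
      using \<alpha>(1) by (simp add: c1_def divide_le_eq mult.commute)
    also have "?S \<le> (1 + s) * D2 \<mu> \<nu> + (1 + 1 / s) * D2 \<mu> \<nu>s"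
      using D2_triangle[OF \<omega>0 dom_P2[OF \<nu>] \<mu> dom_P2[OF \<nu>s] s(1)] by (simp add: D2_commute)
    finally have "c1 \<le> E\<^sub>r \<nu> + A * ((1 + s) * D2 \<mu> \<nu> + (1 + 1 / s) * D2 \<mu> \<nu>s)"
      using A(1) by simp
    also have "\<dots> = E\<^sub>r \<nu> + ((1 + s) * A) * D2 \<mu> \<nu> + A * ((1 + 1 / s) * D2 \<mu> \<nu>s)"
      by (simp add: algebra_simps)
    finally show "c1 - A * ((1 + 1 / s) * D2 \<mu> \<nu>s) \<le> phi \<tau> \<mu> \<nu>"
      unfolding s(2) phi_def by simp
  qed
qed

text \<open>Direct method without compactness: the midpoint estimate makes a good minimizing
  sequence a fast Cauchy sequence, and its limit is a minimizer.\<close>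

lemma minimizer_exists:
  assumes coercive: "coercive_energy \<omega>0 E" and lsc: "lsc_energy \<omega>0 E"
    and \<mu>: "\<mu> \<in> P2 \<omega>0" and \<tau>: "\<tau> > 0" "1 / \<tau> + lam > 0"
  shows "\<exists>\<nu>. minimizer \<tau> \<mu> \<nu>"
proof -
  obtain c where c: "\<And>\<nu>. \<nu> \<in> edom \<Longrightarrow> c \<le> phi \<tau> \<mu> \<nu>"
    using phi_bounded_below[OF coercive \<mu> \<tau>] by metis
  define m where "m = (INF \<nu>\<in>edom. phi \<tau> \<mu> \<nu>)"
  have bdd: "bdd_below (phi \<tau> \<mu> ` edom)" using c by (auto simp: bdd_below_def)
  have m_le: "m \<le> phi \<tau> \<mu> \<nu>" if "\<nu> \<in> edom" for \<nu>
    unfolding m_def using bdd that by (rule cINF_lower)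
  \<comment> \<open>The midpoint gain equals \<open>2 * (\<kappa> * w)\<close>. Excesses below
    \<open>\<kappa> * (1 / 8) ^ n\<close> thus force \<open>w < (1 / 8) ^ n\<close>, the rate the
    completeness lemma asks for.\<close>
  define \<kappa> where "\<kappa> = (1 / \<tau> + lam) / 8"
  have \<kappa>: "\<kappa> > 0" using \<tau> by (simp add: \<kappa>_def)
  have "\<exists>\<nu>\<in>edom. phi \<tau> \<mu> \<nu> < m + \<kappa> * (1 / 8) ^ n" for n
  proof -
    have "(INF \<nu>\<in>edom. phi \<tau> \<mu> \<nu>) < m + \<kappa> * (1 / 8) ^ n"
      using \<kappa> by (simp add: m_def)
    then show ?thesis using dom_nonempty bdd by (subst (asm) cINF_less_iff) auto
  qed
  then obtain \<nu> where \<nu>: "\<And>n. \<nu> n \<in> edom" and small: "\<And>n. phi \<tau> \<mu> (\<nu> n) < m + \<kappa> * (1 / 8) ^ n"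
    by metis
  have fast: "W2sq (\<nu> n) (\<nu> (Suc n)) < ennreal ((1 / 8) ^ n)" for n
  proof -
    obtain \<Omega> w \<nu>' where "D2 (\<nu> n) (\<nu> (Suc n)) \<le> w" "\<nu>' \<in> edom"
      "2 * phi \<tau> \<mu> \<nu>' + (1 / \<tau> + lam) / 4 * w \<le> phi \<tau> \<mu> (\<nu> n) + phi \<tau> \<mu> (\<nu> (Suc n))"
      using midpoint[OF \<mu> \<nu>[of n] \<nu>[of "Suc n"] \<tau>(1)] by metis
    moreover have "(1 / \<tau> + lam) / 4 * w = 2 * (\<kappa> * w)"
      by (simp add: \<kappa>_def)
    moreover have "\<kappa> * (1 / 8) ^ Suc n \<le> \<kappa> * (1 / 8) ^ n"
      using \<kappa> by (intro mult_left_mono power_decreasing) auto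
    ultimately have "\<kappa> * w < \<kappa> * (1 / 8) ^ n"
      using small[of n] small[of "Suc n"] m_le[OF \<open>\<nu>' \<in> edom\<close>] by linarith
    then have "w < (1 / 8) ^ n" using \<kappa> by simp
    then show ?thesis
      using \<open>D2 _ _ \<le> w\<close> D2_nonneg[of "\<nu> n" "\<nu> (Suc n)"]
      by (simp add: W2sq_eq_D2[OF \<omega>0 dom_P2[OF \<nu>] dom_P2[OF \<nu>]] ennreal_less_iff)
  qed
  obtain \<nu>' where \<nu>': "prob_borel \<nu>'" and lim: "(\<lambda>n. W2sq (\<nu> n) \<nu>') \<longlonglongrightarrow> 0"
    using W2sq_fast_Cauchy_convergent[OF P2_prob_borel[OF dom_P2[OF \<nu>]] fast] by metis
  have P: "\<nu>' \<in> P2 \<omega>0"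
  proof -
    have "eventually (\<lambda>n. W2sq (\<nu> n) \<nu>' < 1) sequentially"
      using lim by (intro order_tendstoD(2)) auto
    then obtain n where "W2sq (\<nu> n) \<nu>' < 1"
      by (auto simp: eventually_sequentially)
    then show ?thesis
      by (intro P2_memI[OF \<omega>0 dom_P2[OF \<nu>] \<nu>']) (auto intro: less_trans)
  qed
  have D_lim: "(\<lambda>n. D2 (\<nu> n) \<nu>') \<longlonglongrightarrow> 0"
    using tendsto_enn2real[OF lim[folded ennreal_0]] unfolding D2_def by simp
  have "(\<lambda>n. ennreal (sqrt (D2 (\<nu> n) \<nu>'))) \<longlonglongrightarrow> ennreal (sqrt 0)"
    by (intro tendsto_intros D_lim)
  then have "(\<lambda>n. W2 (\<nu> n) \<nu>') \<longlonglongrightarrow> 0"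
    by (simp add: W2_eq_sqrt_D2[OF \<omega>0 dom_P2[OF \<nu>] P])
  then have E_le: "E \<nu>' \<le> liminf (\<lambda>n. E (\<nu> n))"
    using lsc P dom_P2[OF \<nu>] unfolding lsc_energy_def by blast
  \<comment> \<open>The weighted triangle inequality bounds \<open>D2 \<mu> (\<nu> n)\<close> from
    below, hence \<open>E (\<nu> n)\<close> from above by a convergent sequence \<open>b\<close>.
    The weight \<open>s\<close> tends to 0 afterwards.\<close>
  have bound: "E \<nu>' \<le> ereal (m - D2 \<mu> \<nu>' / ((1 + s) * (2 * \<tau>)))" if s: "s > 0" for s
  proof -
    define b where "b n = m + \<kappa> * (1 / 8) ^ n
        - (D2 \<mu> \<nu>' - (1 + 1 / s) * D2 (\<nu> n) \<nu>') / ((1 + s) * (2 * \<tau>))" for n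
    have "E\<^sub>r (\<nu> n) \<le> b n" for n
    proof -
      have "D2 \<mu> \<nu>' - (1 + 1 / s) * D2 (\<nu> n) \<nu>' \<le> (1 + s) * D2 \<mu> (\<nu> n)"
        using D2_triangle[OF \<omega>0 \<mu> dom_P2[OF \<nu>[of n]] P s] by simp
      then have "(D2 \<mu> \<nu>' - (1 + 1 / s) * D2 (\<nu> n) \<nu>') / ((1 + s) * (2 * \<tau>))
          \<le> (1 + s) * D2 \<mu> (\<nu> n) / ((1 + s) * (2 * \<tau>))"
        using s \<tau> by (intro divide_right_mono) auto
      also have "\<dots> = D2 \<mu> (\<nu> n) / (2 * \<tau>)" using s by simp
      finally show ?thesis using small[of n] by (simp add: b_def phi_def)
    qed
    then have "E (\<nu> n) \<le> ereal (b n)" for n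
      by (simp add: E_eq[OF \<nu>])
    then have "liminf (\<lambda>n. E (\<nu> n)) \<le> liminf (\<lambda>n. ereal (b n))"
      by (intro Liminf_mono) auto
    moreover have "b \<longlonglongrightarrow> m + \<kappa> * 0 - (D2 \<mu> \<nu>' - (1 + 1 / s) * 0) / ((1 + s) * (2 * \<tau>))"
      unfolding b_def using s \<tau> by (intro tendsto_intros D_lim LIMSEQ_realpow_zero) auto
    then have "liminf (\<lambda>n. ereal (b n)) = ereal (m - D2 \<mu> \<nu>' / ((1 + s) * (2 * \<tau>)))"
      by (intro lim_imp_Liminf) auto
    ultimately show ?thesis using E_le by simp
  qed
  have edom: "\<nu>' \<in> edom"
    using P bound[of 1] by (auto simp: edom_def intro: le_less_trans)
  have "E\<^sub>r \<nu>' \<le> m - D2 \<mu> \<nu>' / ((1 + 0) * (2 * \<tau>))"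
  proof (rule tendsto_lowerbound)
    show "((\<lambda>s. m - D2 \<mu> \<nu>' / ((1 + s) * (2 * \<tau>))) \<longlongrightarrow> m - D2 \<mu> \<nu>' / ((1 + 0) * (2 * \<tau>))) (at_right 0)"
      using \<tau> by (intro tendsto_intros) auto
    show "eventually (\<lambda>s. E\<^sub>r \<nu>' \<le> m - D2 \<mu> \<nu>' / ((1 + s) * (2 * \<tau>))) (at_right 0)"
      using eventually_at_right_less[of "0::real"]
    proof eventually_elim
      fix s :: real assume "0 < s"
      then show "E\<^sub>r \<nu>' \<le> m - D2 \<mu> \<nu>' / ((1 + s) * (2 * \<tau>))"
        using bound[of s] E_eq[OF edom] by simp
    qed
  qed simp
  then have "phi \<tau> \<mu> \<nu>' \<le> m" by (simp add: phi_def)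
  then have "minimizer \<tau> \<mu> \<nu>'"
    using edom m_le order_trans unfolding minimizer_iff[OF \<mu>] by blast
  then show ?thesis ..
qed

section \<open>The resolvent along a geodesic\<close>

lemma resolvent_eq:
  assumes "\<mu> \<in> P2 \<omega>0" "\<tau> > 0" "1 / \<tau> + lam > 0" "minimizer \<tau> \<mu> \<nu>"
  shows "resolvent \<omega>0 E \<tau> \<mu> = \<nu>"
  unfolding resolvent_def minimizer_def[symmetric]
  using assms(4) minimizer_unique[OF assms(1-3)] by (intro the_equality) auto

text \<open>The triangle inequality through \<open>?v\<close> compares the functional at \<tau> with
  the one at \<open>h\<close>, up to a term independent of the competitor. The comparison is an
  equality at \<open>u 0\<close>, so minimality is inherited.\<close>

lemma minimizer_along_geodesic:
  assumes h: "0 < h" "h \<le> \<tau>"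
    and geod: "const_speed_geodesic u" and u: "\<forall>\<alpha>\<in>{0..1}. u \<alpha> \<in> P2 \<omega>0"
    and min: "minimizer \<tau> (u 1) (u 0)"
  shows "minimizer h (u (h / \<tau>)) (u 0)"
proof (cases "h = \<tau>")
  \<comment> \<open>Then \<open>h / \<tau> = 1\<close>; the weight used in the other case would
    divide by zero.\<close>
  case True
  then show ?thesis using min h by simp
next
  case False
  then have h': "0 < h" "h < \<tau>" "0 < \<tau>" using h by auto
  let ?t = "h / \<tau>"
  let ?v = "u ?t"
  have t: "?t \<in> {0..1}" using h' by simp
  have P: "u 0 \<in> P2 \<omega>0" "u 1 \<in> P2 \<omega>0" "?v \<in> P2 \<omega>0" using u t by auto
  define D where "D = D2 (u 0) (u 1)"
  have speed: "D2 (u a) (u b) = (b - a)\<^sup>2 * D" if "a \<in> {0..1}" "b \<in> {0..1}" for a b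
  proof -
    have "W2sq (u a) (u b) = (ennreal \<bar>b - a\<bar>)\<^sup>2 * W2sq (u 0) (u 1)"
      using geod that unfolding const_speed_geodesic_def
      by (metis W2_power2 power_mult_distrib)
    then have "enn2real (W2sq (u a) (u b)) = enn2real ((ennreal \<bar>b - a\<bar>)\<^sup>2) * D"
      by (simp add: D_def D2_def enn2real_mult)
    then show ?thesis by (simp add: D2_def ennreal_power)
  qed
  have Dv: "D2 (u 1) ?v = (1 - ?t)\<^sup>2 * D" "D2 ?v (u 0) = ?t\<^sup>2 * D" "D2 (u 1) (u 0) = D"
    using speed[of 1 ?t] speed[of ?t 0] speed[of 1 0] t by (auto simp: power2_commute)
  have u0: "u 0 \<in> edom" and opt: "\<And>\<nu>. \<nu> \<in> edom \<Longrightarrow> phi \<tau> (u 1) (u 0) \<le> phi \<tau> (u 1) \<nu>"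
    using min minimizer_iff[OF P(2)] by blast+
  have "phi h ?v (u 0) \<le> phi h ?v \<nu>" if \<nu>: "\<nu> \<in> edom" for \<nu>
  proof -
    \<comment> \<open>The only weight for which division by \<open>2 * \<tau>\<close> leaves exactly
      the coefficients \<open>1 / (2 * (\<tau> - h))\<close> and \<open>1 / (2 * h)\<close>.\<close>
    let ?s = "h / (\<tau> - h)"
    have s: "?s > 0" "1 + ?s = \<tau> / (\<tau> - h)" "1 + 1 / ?s = \<tau> / h"
      using h' by (auto simp: field_simps)
    have "D2 (u 1) \<nu> \<le> \<tau> / (\<tau> - h) * D2 (u 1) ?v + \<tau> / h * D2 ?v \<nu>"
      using D2_triangle[OF \<omega>0 P(2) P(3) dom_P2[OF \<nu>] s(1)] unfolding s(2,3) .
    then have "D2 (u 1) \<nu> / (2 * \<tau>) \<le> (\<tau> / (\<tau> - h) * D2 (u 1) ?v + \<tau> / h * D2 ?v \<nu>) / (2 * \<tau>)"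
      using h' by (intro divide_right_mono) auto
    also have "\<dots> = D2 (u 1) ?v / (2 * (\<tau> - h)) + D2 ?v \<nu> / (2 * h)"
      using h' by (simp add: add_divide_distrib mult.commute)
    finally have "phi \<tau> (u 1) \<nu> \<le> D2 (u 1) ?v / (2 * (\<tau> - h)) + phi h ?v \<nu>"
      by (simp add: phi_def)
    moreover have "phi \<tau> (u 1) (u 0) = D2 (u 1) ?v / (2 * (\<tau> - h)) + phi h ?v (u 0)"
    proof -
      \<comment> \<open>Constant speed makes the two pieces proportional to
        \<open>\<tau> - h\<close> and \<open>h\<close>, which is the equality case.\<close>
      have "(1 - ?t)\<^sup>2 * D / (2 * (\<tau> - h)) + ?t\<^sup>2 * D / (2 * h) = D / (2 * \<tau>)"
      proof -
        have "1 - ?t = (\<tau> - h) / \<tau>" using h' by (simp add: field_simps)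
        then have "(1 - ?t)\<^sup>2 * D / (2 * (\<tau> - h)) = (\<tau> - h) * D / (2 * \<tau>\<^sup>2)"
          using h' by (simp add: power2_eq_square divide_simps)
        moreover have "?t\<^sup>2 * D / (2 * h) = h * D / (2 * \<tau>\<^sup>2)"
          using h' by (simp add: power2_eq_square)
        moreover have "(\<tau> - h) * D / (2 * \<tau>\<^sup>2) + h * D / (2 * \<tau>\<^sup>2) = D / (2 * \<tau>)"
          using h' by (simp add: power2_eq_square field_simps)
        ultimately show ?thesis by simp
      qed
      then show ?thesis by (simp add: phi_def Dv)
    qed
    ultimately show ?thesis using opt[OF \<nu>] by linarith
  qed
  then show ?thesis using u0 minimizer_iff[OF P(3)] by blast
qed

end

theorem theoremA6:
  fixes \<omega>0 :: "'a::euclidean_space measure"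
    and E :: "'a measure \<Rightarrow> ereal"
    and lam \<tau> h :: real
    and \<mu> :: "'a measure"
    and u :: "real \<Rightarrow> 'a measure"
  assumes \<omega>0: "prob_borel \<omega>0"
    and E_values: "\<forall>\<nu>\<in>P2 \<omega>0. E \<nu> \<noteq> -\<infinity>"
    and proper: "proper_energy \<omega>0 E"
    and coercive: "coercive_energy \<omega>0 E"
    and lsc: "lsc_energy \<omega>0 E"
    and convex: "convex_gen_geod \<omega>0 E lam"
    and \<mu>: "\<mu> \<in> dom_closure \<omega>0 E"
    and h: "0 < h" "h \<le> \<tau>"
    and \<tau>: "lam < 0 \<longrightarrow> \<tau> < 1 / (- lam)"
    and geod: "const_speed_geodesic u"
    and geod_P2: "\<forall>\<alpha>\<in>{0..1}. u \<alpha> \<in> P2 \<omega>0"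
    and start: "u 0 = resolvent \<omega>0 E \<tau> \<mu>"
    and finish: "u 1 = \<mu>"
  shows "resolvent \<omega>0 E \<tau> \<mu> = resolvent \<omega>0 E h (u (h / \<tau>))"
proof -
  interpret convex_energy \<omega>0 E lam
    by (rule convex_energy.intro) fact+
  have \<mu>P: "\<mu> \<in> P2 \<omega>0" using \<mu> by (simp add: dom_closure_def)
  \<comment> \<open>The step-size restriction without division by \<open>lam\<close>. It passes to
    smaller steps, so uniqueness holds at \<open>h\<close> as well.\<close>
  have pos: "1 / t + lam > 0" if "0 < t" "t \<le> \<tau>" for t
  proof (cases "lam < 0")
    case True
    then have "t < 1 / (- lam)" using \<tau> that by linarith
    then show ?thesis using True \<open>0 < t\<close> by (simp add: field_simps)
  next
    case False
    then show ?thesis using \<open>0 < t\<close> by (simp add: add_pos_nonneg)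
  qed
  have \<tau>0: "0 < \<tau>" using h by linarith
  \<comment> \<open>\<open>resolvent\<close> is a definite description, so existence and uniqueness
    are what turn \<open>start\<close> into minimality of \<open>u 0\<close>.\<close>
  obtain \<nu> where \<nu>: "minimizer \<tau> \<mu> \<nu>"
    using minimizer_exists[OF coercive lsc \<mu>P \<tau>0 pos[OF \<tau>0 order_refl]] by blast
  have r: "resolvent \<omega>0 E \<tau> \<mu> = \<nu>"
    by (rule resolvent_eq[OF \<mu>P \<tau>0 pos[OF \<tau>0 order_refl] \<nu>])
  then have "minimizer \<tau> (u 1) (u 0)" using \<nu> start finish by simp
  then have "minimizer h (u (h / \<tau>)) (u 0)"
    by (rule minimizer_along_geodesic[OF h geod geod_P2])
  then have "resolvent \<omega>0 E h (u (h / \<tau>)) = u 0"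
    using h \<tau>0 geod_P2 by (intro resolvent_eq pos) auto
  then show ?thesis using start by simp
qed

end
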